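(* Let $f:\mathcal E\to[0,\infty]$ be concave and upper semicontinuous with $S_0:=\operatorname{cl}(\operatorname{dom} f)$ bounded, i.e. $D_0:=D(S_0)<\infty$; let $S_1,\dots,S_m\subseteq\mathcal E$ be closed and convex, $\mathcal S:=\bigcap_{j=1}^m S_j$; let $e_0\in\operatorname{int}S_0$, $R_0:=R_{e_0}(S_0)>0$, and let $e_j\in\operatorname{int}S_j$ for $j=1,\dots,m$. Set $$\varphi_{\mathcal S}=\max\{\gamma_{S_1,e_1}^2,\dots,\gamma_{S_m,e_m}^2\},\qquad\mathtt{fom}=\mathtt{genGrad}.$$ Suppose there exist $x^*\in\mathcal S$ with $f(x^* )=p^*:=\max_{x\in\mathcal S}f(x)>0$ and $x_{SL}\in\operatorname{int}\mathcal S\cap\operatorname{dom}f$ such that $\eta:=(1-\gamma_{S_0,e_0}(x^* ))(1-\varphi_{\mathcal S}(x_{SL}))>0$. Suppose moreover that $f$ is twice continuously differentiable and $\beta$-smooth and that each $S_j$ ($1\le j\le m$) is $\beta$-smooth and compact. Let $x_0\in\operatorname{dom}f\cap\mathcal S$, $\tau_0=1/f(x_0)$, $b\ge2$. Then, for all $\varepsilon>0$, the Parallel MultiRadial Method with integer $N\ge\log_b\!\big(\frac{bp^*}{c_{\tau_0}\rho\,\varepsilon}\big)$, $N>0$, finds a feasible $\varepsilon$-minimizer, i.e. $y^{best}_i\in\mathcal S$ with $p^*-f(y^{best}_i)\le\varepsilon$, within $O(1/\sqrt\varepsilon)$ iterations $i$ (the $O$ is as $\varepsilon\to0$, with constant depending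 on the problem data, $x_0$, $b$ and the method's constants, but not on $\varepsilon$ or $N$).
   Context: $\mathcal E$ is a finite-dimensional Euclidean space with inner product and induced norm $\|\cdot\|$. For $f:\mathcal E\to[0,\infty]$: $\operatorname{dom}f=\{x: 0<f(x)<\infty\}$, $\operatorname{hypo}f=\{(x,u)\in\mathcal E\times(0,\infty): f(x)\ge u\}$, and $f$ is concave if $\operatorname{hypo}f$ is convex. $f$ twice continuously differentiable means that $\operatorname{dom}f$ is open and $f$ is $C^2$ on it; $f$ is $\beta$-smooth if $\nabla f$ is $\beta$-Lipschitz on $\operatorname{dom}f$. A set $S$ is $\beta$-smooth if any unit vectors $\xi_1\in N_S(x_1)$, $\xi_2\in N_S(x_2)$ at boundary points $x_1,x_2$ of $S$ satisfy $\|\xi_1-\xi_2\|\le\beta\|x_1-x_2\|$, where $N_S(x)=\{\xi:\langle\xi,x'-x\rangle\le0\ \forall x'\in S\}$. For a set $S$ and $e\in S$: $\gamma_{S,e}(x)=\inf\{v>0: e+\frac{x-e}{v}\in S\}$, $R_e(S)=\inf\{\|x-e\|: x\notin S\}$, $D(S)=\sup\{\|x-y\|: x,y\in S\}$. The radial transform is $f^{\Gamma,e}(y)=\sup\{v>0: v f(e+\frac{y-e}{v})\le1\}$, $\sup\emptyset=0$. For $\tau>0$: $\Phi_\tau(y)=\max\{(\tau f)^{\Gamma,e_0}(y),\varphi_{\mathcal S}(y)\}$, $\rho=\frac{R_0}{D_0+R_0}$, $c_\tau=\frac{1}{\tau p^*}\frac{R_0}{D_0+R_0}\eta$. Accelerated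 generalized gradient method $\mathtt{genGrad}$ on $h=\max\{h_0,\dots,h_m\}$, each $h_j$ convex and $L$-smooth: any accelerated gradient method in which the gradient at $y$ is replaced by the generalized gradient mapping $\mathcal G(y,\alpha)=\frac1\alpha\big(y-\operatorname{argmin}_{y'}\{\max_{0\le j\le m}\{h_j(y)+\langle\nabla h_j(y),y'-y\rangle\}+\frac1{2\alpha}\|y'-y\|^2\}\big)$ with $\alpha=1/L$, started at $y_0=x$, having the (known) guarantee: if $\|y_0-y^*\|\le D$ for some minimizer $y^*$ of $h$, then for every $\epsilon>0$ some iterate $i\le2\sqrt{LD^2/\epsilon}$ has $h(y_i)-h(y^* )\le\epsilon$. Applied to $\Phi_\tau$, the components are $h_0=(\tau f)^{\Gamma,e_0}$, $h_j=\gamma_{S_j,e_j}^2$, and $L$ is a fixed constant valid for these components for all $\tau\in[1/p^*,\tau_0]$. Parallel MultiRadial Method (inputs $f,e_0,\varphi_{\mathcal S},x_0\in\operatorname{dom}f\cap\mathcal S$, $b\ge2$, integer $N>0$, first-order method $\mathtt{fom}$). Set $\delta^{(l)}=b^{-l}$ and $\tau^{(l)}_0=1/f(x_0)$ for $l=1,\dots,N$, and initialize instance $l$ of $\mathtt{fom}$ on $\Phi_{\tau^{(l)}_0}$ with target accuracy $\delta^{(l)}$ at $y^{(l)}_0=x_0$. For $i=0,1,2,\dots$: (1) for each $l$ set $\tau^{(l)}_{i+1}=\tau^{(l)}_i$ and let $y^{(l)}_{i+1}$ be the next iterate of instance $l$ (one step on $\Phi_{\tau^{(l)}_i}$); (2)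 let $y^{best}_{i+1}$ minimize $1/f$ (i.e. maximize $f$) among all iterates $y^{(l)}_{i'}$, $i'\le i+1$, $1\le l\le N$, produced so far that lie in $\mathcal S$, and $\tau^{best}_{i+1}=1/f(y^{best}_{i+1})$; (3) for each $l$ with $\tau^{best}_{i+1}\le\frac{1}{1+\delta^{(l)}}\tau^{(l)}_i$, set $\tau^{(l)}_{i+1}=\tau^{best}_{i+1}$ and restart (reinitialize all variables of) instance $l$ on $\Phi_{\tau^{(l)}_{i+1}}$ with target accuracy $\delta^{(l)}$ at $y^{(l)}_{i+1}=y^{best}_{i+1}$. *)

theory Defs
  imports "HOL-Analysis.Analysis" "HOL-Library.Landau_Symbols"
begin

section \<open>Functions with values in \<open>[0,\<infinity>]\<close>\<close>

definition eff_dom :: "('a \<Rightarrow> ennreal) \<Rightarrow> 'a set" where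
  "eff_dom f = {x. 0 < f x \<and> f x < \<infinity>}"

definition hypo :: "('a \<Rightarrow> ennreal) \<Rightarrow> ('a \<times> real) set" where
  "hypo f = {(x, u). 0 < u \<and> ennreal u \<le> f x}"

definition hypo_concave :: "('a::real_vector \<Rightarrow> ennreal) \<Rightarrow> bool" where
  "hypo_concave f \<longleftrightarrow> convex (hypo f)"

definition upper_semicontinuous :: "('a::topological_space \<Rightarrow> ennreal) \<Rightarrow> bool" where
  "upper_semicontinuous f \<longleftrightarrow> (\<forall>u. closed {x. u \<le> f x})"

section \<open>Smoothness\<close>

definition grad :: "('a::real_inner \<Rightarrow> real) \<Rightarrow> 'a \<Rightarrow> 'a" where
  "grad F x = (THE D. GDERIV F x :> D)"

definition smooth_on :: "real \<Rightarrow> 'a::real_inner set \<Rightarrow> ('a \<Rightarrow> real) \<Rightarrow> bool" where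
  "smooth_on L X F \<longleftrightarrow> (\<forall>x\<in>X. F differentiable at x) \<and> L-lipschitz_on X (grad F)"

definition C2_on :: "'a::real_inner set \<Rightarrow> ('a \<Rightarrow> real) \<Rightarrow> bool" where
  "C2_on X F \<longleftrightarrow> (\<forall>x\<in>X. F differentiable at x) \<and>
     (\<exists>H :: 'a \<Rightarrow> ('a \<Rightarrow>\<^sub>L 'a).
        (\<forall>x\<in>X. (grad F has_derivative blinfun_apply (H x)) (at x)) \<and> continuous_on X H)"

definition normal_cone :: "'a::real_inner set \<Rightarrow> 'a \<Rightarrow> 'a set" where
  "normal_cone S x = {\<xi>. \<forall>x'\<in>S. \<xi> \<bullet> (x' - x) \<le> 0}"

definition smooth_set :: "real \<Rightarrow> 'a::real_inner set \<Rightarrow> bool" where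
  "smooth_set \<beta> S \<longleftrightarrow>
     (\<forall>x1\<in>frontier S. \<forall>x2\<in>frontier S. \<forall>\<xi>1\<in>normal_cone S x1. \<forall>\<xi>2\<in>normal_cone S x2.
        norm \<xi>1 = 1 \<longrightarrow> norm \<xi>2 = 1 \<longrightarrow> norm (\<xi>1 - \<xi>2) \<le> \<beta> * norm (x1 - x2))"

section \<open>Gauges, radii and radial transforms\<close>

text \<open>In \<^typ>\<open>ennreal\<close>, the infimum of the empty set is \<open>\<infinity>\<close> and the supremum of the empty set is
  \<open>0\<close>, which are the conventions needed here.\<close>

definition set_gauge :: "'a::real_vector set \<Rightarrow> 'a \<Rightarrow> 'a \<Rightarrow> ennreal" where
  "set_gauge S e x = (INF v\<in>{v::real. 0 < v \<and> e + (x - e) /\<^sub>R v \<in> S}. ennreal v)"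

definition radial_transform :: "('a::real_vector \<Rightarrow> ennreal) \<Rightarrow> 'a \<Rightarrow> 'a \<Rightarrow> ennreal" where
  "radial_transform f e y =
     (SUP v\<in>{v::real. 0 < v \<and> ennreal v * f (e + (y - e) /\<^sub>R v) \<le> 1}. ennreal v)"

text \<open>Only used for bounded sets, whose complement is nonempty.\<close>

definition inner_radius :: "'a::real_normed_vector \<Rightarrow> 'a set \<Rightarrow> real" where
  "inner_radius e S = (INF x\<in>- S. norm (x - e))"

definition phi_S :: "nat \<Rightarrow> (nat \<Rightarrow> 'a::real_vector set) \<Rightarrow> (nat \<Rightarrow> 'a) \<Rightarrow> 'a \<Rightarrow> ennreal" where
  "phi_S m S e x = Max ((\<lambda>j. (set_gauge (S j) (e j) x)\<^sup>2) ` {1..m})"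

definition Phi :: "('a \<Rightarrow> ennreal) \<Rightarrow> 'a \<Rightarrow> nat \<Rightarrow> (nat \<Rightarrow> 'a::real_vector set) \<Rightarrow> (nat \<Rightarrow> 'a) \<Rightarrow>
    real \<Rightarrow> 'a \<Rightarrow> ennreal" where
  "Phi f e0 m S e \<tau> y =
     max (radial_transform (\<lambda>x. ennreal \<tau> * f x) e0 y) (phi_S m S e y)"

text \<open>The \<open>m + 1\<close> component functions of \<open>\<Phi>\<^sub>\<tau>\<close> as real-valued functions.  The conversion to \<open>real\<close>
  loses nothing as long as the gauges and the radial transform are finite, as they are for centres
  \<open>e\<^sub>j\<close> in the interior of \<open>S\<^sub>j\<close>.\<close>

definition Phi_component :: "('a \<Rightarrow> ennreal) \<Rightarrow> 'a \<Rightarrow> (nat \<Rightarrow> 'a::real_vector set) \<Rightarrow> (nat \<Rightarrow> 'a) \<Rightarrow>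
    real \<Rightarrow> nat \<Rightarrow> 'a \<Rightarrow> real" where
  "Phi_component f e0 S e \<tau> j y =
     (if j = 0 then enn2real (radial_transform (\<lambda>x. ennreal \<tau> * f x) e0 y)
      else (enn2real (set_gauge (S j) (e j) y))\<^sup>2)"

definition valid_smoothness :: "('a::real_inner \<Rightarrow> ennreal) \<Rightarrow> 'a \<Rightarrow> nat \<Rightarrow> (nat \<Rightarrow> 'a set) \<Rightarrow>
    (nat \<Rightarrow> 'a) \<Rightarrow> real set \<Rightarrow> real \<Rightarrow> bool" where
  "valid_smoothness f e0 m S e T L \<longleftrightarrow>
     0 < L \<and> (\<forall>\<tau>\<in>T. \<forall>j\<le>m. smooth_on L UNIV (Phi_component f e0 S e \<tau> j))"

definition max_fun :: "nat \<Rightarrow> (nat \<Rightarrow> 'a \<Rightarrow> real) \<Rightarrow> 'a \<Rightarrow> real" where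
  "max_fun m h y = (MAX j\<in>{..m}. h j y)"

lemma max_fun_Phi_component:
  assumes "m \<ge> 1"
    and "radial_transform (\<lambda>x. ennreal \<tau> * f x) e0 y < \<infinity>"
    and "\<And>j. j \<in> {1..m} \<Longrightarrow> set_gauge (S j) (e j) y < \<infinity>"
  shows "ennreal (max_fun m (Phi_component f e0 S e \<tau>) y) = Phi f e0 m S e \<tau> y"
proof -
  let ?h = "\<lambda>j. Phi_component f e0 S e \<tau> j y"
  have mono: "mono ennreal"
    by (auto simp: mono_def intro: ennreal_leI)
  have split: "{..m} = insert 0 {1..m}" by auto
  have "ennreal (max_fun m (Phi_component f e0 S e \<tau>) y) = Max (ennreal ` ?h ` {..m})"
    unfolding max_fun_def by (rule mono_Max_commute[OF mono]) auto
  also have "\<dots> = Max ((\<lambda>j. ennreal (?h j)) ` {..m})"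
    by (simp add: image_image)
  also have "\<dots> = max (ennreal (?h 0)) (Max ((\<lambda>j. ennreal (?h j)) ` {1..m}))"
    unfolding split image_insert using assms(1) by (subst Max_insert) auto
  also have "(\<lambda>j. ennreal (?h j)) ` {1..m} = (\<lambda>j. (set_gauge (S j) (e j) y)\<^sup>2) ` {1..m}"
    using assms(3) by (intro image_cong) (auto simp: Phi_component_def ennreal_power[symmetric])
  also have "ennreal (?h 0) = radial_transform (\<lambda>x. ennreal \<tau> * f x) e0 y"
    using assms(2) by (simp add: Phi_component_def)
  finally show ?thesis by (simp add: Phi_def phi_S_def)
qed

section \<open>Accelerated generalized gradient method\<close>

definition gen_grad_map :: "nat \<Rightarrow> (nat \<Rightarrow> 'a::real_inner \<Rightarrow> real) \<Rightarrow> real \<Rightarrow> 'a \<Rightarrow> 'a" where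
  "gen_grad_map m h \<alpha> y =
     (y - arg_min (\<lambda>y'. (MAX j\<in>{..m}. h j y + grad (h j) y \<bullet> (y' - y)) + (norm (y' - y))\<^sup>2 / (2 * \<alpha>))
            (\<lambda>_. True)) /\<^sub>R \<alpha>"

text \<open>A gradient method: a state machine with states \<open>'s\<close> that knows the stepsize and accesses the
  objective only through a gradient oracle \<open>'a \<Rightarrow> 'a\<close>.\<close>

record ('a, 's) gradient_method =
  gm_init :: "real \<Rightarrow> 'a \<Rightarrow> 's"
  gm_step :: "real \<Rightarrow> ('a \<Rightarrow> 'a) \<Rightarrow> 's \<Rightarrow> 's"
  gm_iterate :: "'s \<Rightarrow> 'a"

definition genGrad_init :: "('a, 's) gradient_method \<Rightarrow> real \<Rightarrow> 'a \<Rightarrow> 's" where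
  "genGrad_init G L x = gm_init G (1 / L) x"

definition genGrad_step :: "('a::real_inner, 's) gradient_method \<Rightarrow> real \<Rightarrow>
    nat \<Rightarrow> (nat \<Rightarrow> 'a \<Rightarrow> real) \<Rightarrow> 's \<Rightarrow> 's" where
  "genGrad_step G L m h = gm_step G (1 / L) (gen_grad_map m h (1 / L))"

text \<open>The iteration bound \<open>2 \<surd>(L D\<^sup>2 / \<epsilon>)\<close> is rounded up.  Without rounding it would, whenever it is
  below \<open>1\<close>, constrain the starting point itself; no method achieves that for a maximum of several
  smooth functions (take \<open>\<bar>x\<bar> = max x (- x)\<close>, which is such a maximum for every \<open>L > 0\<close>).\<close>

definition accelerated_genGrad :: "('a::real_inner, 's) gradient_method \<Rightarrow> bool" where
  "accelerated_genGrad G \<longleftrightarrow>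
     (\<forall>L>0. \<forall>x. gm_iterate G (genGrad_init G L x) = x) \<and>
     (\<forall>m (h :: nat \<Rightarrow> 'a \<Rightarrow> real) L x y D.
        0 < L \<longrightarrow> (\<forall>j\<le>m. convex_on UNIV (h j) \<and> smooth_on L UNIV (h j)) \<longrightarrow>
        (\<forall>y'. max_fun m h y \<le> max_fun m h y') \<longrightarrow> norm (x - y) \<le> D \<longrightarrow>
        (\<forall>\<epsilon>>0. \<exists>i. int i \<le> \<lceil>2 * sqrt (L * D\<^sup>2 / \<epsilon>)\<rceil> \<and>
           max_fun m h (gm_iterate G ((genGrad_step G L m h ^^ i) (genGrad_init G L x)))
             - max_fun m h y \<le> \<epsilon>))"

section \<open>Parallel MultiRadial Method\<close>

text \<open>A first-order method run on the family \<open>\<Phi>\<^sub>\<tau>\<close> is given by \<open>init \<tau> \<delta> x\<close> (its initial state on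
  \<open>\<Phi>\<^sub>\<tau>\<close> with target accuracy \<open>\<delta>\<close> at \<open>x\<close>), \<open>step \<tau>\<close> (one iteration on \<open>\<Phi>\<^sub>\<tau>\<close>) and \<open>iter\<close> (the
  current iterate in a state).  A run consists of \<open>\<tau> l i\<close>, \<open>s l i\<close> (parameter and state of instance
  \<open>l\<close> after round \<open>i\<close>) and \<open>ybest i\<close>, the latter being meaningful for \<open>i \<ge> 1\<close>.\<close>

text \<open>All iterates of all instances up to round \<open>i + 1\<close>, including those that are replaced
  by a restart at the end of the round that produced them.\<close>

definition produced_iterates :: "(real \<Rightarrow> 's \<Rightarrow> 's) \<Rightarrow> ('s \<Rightarrow> 'a) \<Rightarrow> nat \<Rightarrow>
    (nat \<Rightarrow> nat \<Rightarrow> real) \<Rightarrow> (nat \<Rightarrow> nat \<Rightarrow> 's) \<Rightarrow> nat \<Rightarrow> 'a set" where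
  "produced_iterates step iter N \<tau> s i =
     {iter (s l k) | l k. l \<in> {1..N} \<and> k \<le> i} \<union>
     {iter (step (\<tau> l k) (s l k)) | l k. l \<in> {1..N} \<and> k \<le> i}"

definition parallel_multiradial_run ::
  "(real \<Rightarrow> real \<Rightarrow> 'a \<Rightarrow> 's) \<Rightarrow> (real \<Rightarrow> 's \<Rightarrow> 's) \<Rightarrow> ('s \<Rightarrow> 'a) \<Rightarrow>
   ('a \<Rightarrow> ennreal) \<Rightarrow> 'a set \<Rightarrow> 'a \<Rightarrow> real \<Rightarrow> nat \<Rightarrow>
   (nat \<Rightarrow> nat \<Rightarrow> real) \<Rightarrow> (nat \<Rightarrow> nat \<Rightarrow> 's) \<Rightarrow> (nat \<Rightarrow> 'a) \<Rightarrow> bool" where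
  "parallel_multiradial_run init step iter f SS x0 b N \<tau> s ybest \<longleftrightarrow>
     (\<forall>l\<in>{1..N}. \<tau> l 0 = 1 / enn2real (f x0) \<and> s l 0 = init (\<tau> l 0) ((1 / b) ^ l) x0) \<and>
     (\<forall>i. is_arg_max f (\<lambda>y. y \<in> produced_iterates step iter N \<tau> s i \<inter> SS) (ybest (Suc i))) \<and>
     (\<forall>i. \<forall>l\<in>{1..N}.
        let \<delta> = (1 / b) ^ l; \<tau>best = 1 / enn2real (f (ybest (Suc i))) in
        if \<tau>best \<le> 1 / (1 + \<delta>) * \<tau> l i
        then \<tau> l (Suc i) = \<tau>best \<and> s l (Suc i) = init \<tau>best \<delta> (ybest (Suc i))
        else \<tau> l (Suc i) = \<tau> l i \<and> s l (Suc i) = step (\<tau> l i) (s l i))"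

end

theory Submission
  imports Defs
begin

text \<open>
  Each component of \<open>\<Phi>\<^sub>\<tau>\<close> has an explicit subgradient selection that is Lipschitz; this gives convexity
  and smoothness at once.  For the radial transform it is
  \<open>- \<nabla>f(x) / (f(x) - \<langle>\<nabla>f(x), x - e\<^sub>0\<rangle>)\<close> at the radial projection \<open>x\<close> of the point, and for a squared gauge
  it is built from the unit normal at the radial projection onto the boundary.

  For \<open>\<theta> = 1 / (\<tau> p\<^sup>*)\<close> a suitable point between \<open>x\<^sup>*\<close> and the Slater point shows
  \<open>min \<Phi>\<^sub>\<tau> \<le> 1 - \<eta> (1 - \<theta>) \<rho> / (1 + \<rho>)\<close>, while \<open>\<Phi>\<^sub>\<tau> y \<le> 1 - \<delta> / \<rho>\<close> makes \<open>y\<close> feasible with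
  \<open>\<tau> f y \<ge> 1 + \<delta>\<close>, the restart condition.  Hence instance \<open>l\<close> restarts within
  \<open>O(b\<^bsup>l/2\<^esup>)\<close> rounds as long as \<open>p\<^sup>* - 1 / \<tau>\<close> exceeds \<open>A b\<^bsup>-l\<^esup> p\<^sup>*\<close>, and boundedly many
  restarts of instance \<open>l\<close> reduce the gap of the best iterate from \<open>A b\<^bsup>-(l-1)\<^esup> p\<^sup>*\<close> to \<open>A b\<^bsup>-l\<^esup> p\<^sup>*\<close>.
  The costs of the levels \<open>b\<^sup>l \<lesssim> 1 / \<epsilon>\<close> sum geometrically to \<open>O(1 / \<surd>\<epsilon>)\<close>.
\<close>

section \<open>Gradients and subgradients\<close>

lemma grad_eqI:
  fixes F :: "'a::real_inner \<Rightarrow> real"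
  assumes "GDERIV F x :> D"
  shows "grad F x = D"
  unfolding grad_def
proof (rule the_equality)
  show "GDERIV F x :> D" by (rule assms)
next
  fix D' assume "GDERIV F x :> D'"
  then have "(\<lambda>h. h \<bullet> D') = (\<lambda>h. h \<bullet> D)"
    using assms unfolding gderiv_def by (metis has_derivative_unique)
  then have "(D' - D) \<bullet> (D' - D) = 0"
    by (metis inner_diff_right right_minus_eq)
  then show "D' = D" by simp
qed

text \<open>The derivative is represented by the vector whose coordinates are its values on
  \<open>Basis\<close>.\<close>

lemma GDERIV_grad:
  fixes F :: "'a::euclidean_space \<Rightarrow> real"
  assumes "F differentiable at x"
  shows "GDERIV F x :> grad F x"
proof -
  obtain F' where F': "(F has_derivative F') (at x)"
    using assms by (auto simp: differentiable_def)
  interpret bounded_linear F' using F' by (rule has_derivative_bounded_linear)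
  have "F' h = h \<bullet> (\<Sum>i\<in>Basis. F' i *\<^sub>R i)" for h
  proof -
    have "F' h = F' (\<Sum>i\<in>Basis. (h \<bullet> i) *\<^sub>R i)" by (simp add: euclidean_representation)
    also have "\<dots> = (\<Sum>i\<in>Basis. (h \<bullet> i) * F' i)" by (simp add: sum scaleR)
    finally show ?thesis by (simp add: inner_sum_right mult.commute)
  qed
  then have "GDERIV F x :> (\<Sum>i\<in>Basis. F' i *\<^sub>R i)"
    using F' unfolding gderiv_def by (metis (no_types, lifting) ext)
  then show ?thesis using grad_eqI by metis
qed

text \<open>Adding the subgradient inequalities at the intermediate point \<open>z\<close>, weighted
  by \<open>1 - t\<close> and \<open>t\<close>, cancels the linear terms.\<close>

lemma convex_on_subgradient:
  fixes v :: "'a::real_inner \<Rightarrow> real"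
  assumes sub: "\<And>x y. v x + g x \<bullet> (y - x) \<le> v y"
  shows "convex_on UNIV v"
proof (rule convex_onI)
  fix t :: real and x y :: 'a
  assume t: "0 < t" "t < 1"
  define z where "z = (1 - t) *\<^sub>R x + t *\<^sub>R y"
  have "(1 - t) * (v z + g z \<bullet> (x - z)) \<le> (1 - t) * v x" "t * (v z + g z \<bullet> (y - z)) \<le> t * v y"
    using sub t by (intro mult_left_mono; simp)+
  moreover have "(1 - t) * (v z + g z \<bullet> (x - z)) + t * (v z + g z \<bullet> (y - z))
      = v z + g z \<bullet> ((1 - t) *\<^sub>R (x - z) + t *\<^sub>R (y - z))"
    by (simp add: inner_add_right algebra_simps)
  moreover have "(1 - t) *\<^sub>R (x - z) + t *\<^sub>R (y - z) = 0"
    by (simp add: z_def algebra_simps)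
  ultimately show "v ((1 - t) *\<^sub>R x + t *\<^sub>R y) \<le> (1 - t) * v x + t * v y"
    by (simp add: z_def)
qed simp

text \<open>A Lipschitz subgradient selection is a gradient: the subgradient inequalities at
  \<open>x\<close> and at \<open>y\<close> squeeze the first-order error between 0 and
  \<open>(y - x) \<bullet> (g y - g x)\<close>, which is quadratically small.\<close>

lemma smooth_on_subgradient:
  fixes v :: "'a::real_inner \<Rightarrow> real"
  assumes sub: "\<And>x y. v x + g x \<bullet> (y - x) \<le> v y"
    and lip: "L-lipschitz_on UNIV g"
  shows "smooth_on L UNIV v"
proof -
  have L: "0 \<le> L" using lip by (rule lipschitz_on_nonneg)
  have D: "GDERIV v x :> g x" for x
    unfolding gderiv_def has_derivative_at_alt
  proof (intro conjI allI impI)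
    show "bounded_linear (\<lambda>h. h \<bullet> g x)" by (rule bounded_linear_inner_left)
    fix r :: real assume r: "0 < r"
    \<comment> \<open>\<open>L + 1\<close> instead of \<open>L\<close> keeps the radius meaningful
      when \<open>L = 0\<close>.\<close>
    have "norm (v y - v x - (y - x) \<bullet> g x) \<le> r * norm (y - x)" if y: "norm (y - x) < r / (L + 1)" for y
    proof -
      have 0: "0 \<le> v y - v x - (y - x) \<bullet> g x" using sub[of x y] by (simp add: inner_commute)
      have "v y - v x - (y - x) \<bullet> g x \<le> (y - x) \<bullet> (g y - g x)"
        using sub[of y x] by (simp add: inner_diff_left inner_diff_right inner_commute)
      also have "\<dots> \<le> norm (y - x) * norm (g y - g x)" by (rule norm_cauchy_schwarz)
      also have "\<dots> \<le> norm (y - x) * (L * norm (y - x))"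
        using lipschitz_onD[OF lip, of y x] by (intro mult_left_mono) (auto simp: dist_norm)
      also have "\<dots> \<le> norm (y - x) * r"
      proof (intro mult_left_mono)
        have "L * norm (y - x) \<le> (L + 1) * norm (y - x)" by (intro mult_right_mono) auto
        also have "\<dots> \<le> r" using y L by (simp add: field_simps)
        finally show "L * norm (y - x) \<le> r" .
      qed simp
      finally show ?thesis using 0 by (simp add: mult.commute)
    qed
    then show "\<exists>d>0. \<forall>y. norm (y - x) < d \<longrightarrow> norm (v y - v x - (y - x) \<bullet> g x) \<le> r * norm (y - x)"
      using r L by (intro exI[of _ "r / (L + 1)"]) auto
  qed
  have "grad v = g" using grad_eqI[OF D] by auto
  moreover have "v differentiable at x" for x
    using D[of x] unfolding gderiv_def differentiable_def by blast
  ultimately show ?thesis using lip by (simp add: smooth_on_def)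
qed

lemma smooth_on_mono: "smooth_on L X F \<Longrightarrow> L \<le> L' \<Longrightarrow> smooth_on L' X F"
  unfolding smooth_on_def using lipschitz_on_le by blast

lemma concave_on_combination:
  assumes "concave_on X F" "x \<in> X" "y \<in> X" "0 \<le> u" "0 \<le> v" "u + v = 1"
  shows "u * F x + v * F y \<le> F (u *\<^sub>R x + v *\<^sub>R y)"
  using assms unfolding concave_on_iff by blast

text \<open>Along the segment the difference quotients at \<open>x\<close> are at least
  \<open>F y - F x\<close> by concavity; letting \<open>t\<close> decrease to 0 turns them into the
  directional derivative.\<close>

lemma concave_on_gradient_le:
  fixes F :: "'a::real_inner \<Rightarrow> real"
  assumes F: "concave_on X F" and D: "GDERIV F x :> D" and x: "x \<in> X" and y: "y \<in> X"
  shows "F y \<le> F x + D \<bullet> (y - x)"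
proof -
  define \<phi> where "\<phi> = (\<lambda>t. F (x + t *\<^sub>R (y - x)))"
  have "((\<lambda>t. x + t *\<^sub>R (y - x)) has_derivative (\<lambda>t. t *\<^sub>R (y - x))) (at 0)"
    by (auto intro!: derivative_eq_intros)
  moreover have "(F has_derivative (\<lambda>h. h \<bullet> D)) (at (x + 0 *\<^sub>R (y - x)))"
    using D by (simp add: gderiv_def)
  ultimately have "(\<phi> has_derivative (\<lambda>t. (t *\<^sub>R (y - x)) \<bullet> D)) (at 0)"
    unfolding \<phi>_def by (rule has_derivative_compose)
  then have "(\<phi> has_field_derivative D \<bullet> (y - x)) (at 0)"
    by (simp add: has_field_derivative_def inner_commute mult_commute_abs)
  then have "((\<lambda>t. (\<phi> t - \<phi> 0) / (t - 0)) \<longlongrightarrow> D \<bullet> (y - x)) (at_right 0)"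
    using has_field_derivative_at_within has_field_derivative_iff by blast
  moreover have "\<forall>\<^sub>F t in at_right 0. F y - F x \<le> (\<phi> t - \<phi> 0) / (t - 0)"
  proof -
    have "F y - F x \<le> (\<phi> t - \<phi> 0) / (t - 0)" if t: "0 < t" "t < 1" for t
    proof -
      have "(1 - t) * F x + t * F y \<le> F ((1 - t) *\<^sub>R x + t *\<^sub>R y)"
        using F t x y unfolding concave_on_iff by auto
      also have "(1 - t) *\<^sub>R x + t *\<^sub>R y = x + t *\<^sub>R (y - x)" by (simp add: algebra_simps)
      finally show ?thesis using t by (simp add: \<phi>_def field_simps)
    qed
    then show ?thesis using eventually_at_right_less[of "0::real"] eventually_at_right_real[of 0 1]
      by (auto elim: eventually_mono)
  qed
  ultimately have "F y - F x \<le> D \<bullet> (y - x)"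
    by (rule tendsto_lowerbound) simp
  then show ?thesis by simp
qed

text \<open>Quotient rule for Lipschitz maps with a denominator bounded away from 0; it serves both
  the scaled normals of a body and \<open>rad_grad\<close>.\<close>

lemma lipschitz_on_scaleR_inverse:
  fixes n :: "'a::metric_space \<Rightarrow> 'b::real_normed_vector" and d :: "'a \<Rightarrow> real"
  assumes n: "K-lipschitz_on X n" and B: "\<And>x. x \<in> X \<Longrightarrow> norm (n x) \<le> B"
    and d: "M-lipschitz_on X d" and d0: "\<And>x. x \<in> X \<Longrightarrow> d0 \<le> d x" "0 < d0"
    and B0: "0 \<le> B"
  shows "(K / d0 + B * M / d0\<^sup>2)-lipschitz_on X (\<lambda>x. n x /\<^sub>R d x)"
proof (rule lipschitz_onI)
  have K: "0 \<le> K" and M: "0 \<le> M" using n d by (auto dest: lipschitz_on_nonneg)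
  show "0 \<le> K / d0 + B * M / d0\<^sup>2" using K M d0 B0 by simp
  fix x y assume x: "x \<in> X" and y: "y \<in> X"
  have px: "0 < d x" and py: "0 < d y" using d0 x y by (auto intro: less_le_trans)
  \<comment> \<open>The difference splits into a change of the numerator over \<open>d x\<close> and
    a change of the denominator acting on \<open>n y\<close>.\<close>
  have "n x /\<^sub>R d x - n y /\<^sub>R d y = (n x - n y) /\<^sub>R d x + ((d y - d x) / (d x * d y)) *\<^sub>R n y"
    using px py by (simp add: algebra_simps divide_simps flip: scaleR_add_left)
  then have "dist (n x /\<^sub>R d x) (n y /\<^sub>R d y) \<le> norm (n x - n y) / d x + \<bar>d y - d x\<bar> / (d x * d y) * norm (n y)"
    using px py norm_triangle_ineq[of "(n x - n y) /\<^sub>R d x" "((d y - d x) / (d x * d y)) *\<^sub>R n y"]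
    by (simp add: dist_norm divide_inverse mult.commute abs_mult)
  also have "\<dots> \<le> (K * dist x y) / d0 + (M * dist x y) / (d0 * d0) * B"
  proof (intro add_mono mult_mono frac_le)
    show "norm (n x - n y) \<le> K * dist x y" using lipschitz_onD[OF n x y] by (simp add: dist_norm)
    show "\<bar>d y - d x\<bar> \<le> M * dist x y"
      using lipschitz_onD[OF d y x] by (simp add: dist_real_def dist_commute)
  qed (use K M d0 x y px py B B0 in \<open>auto intro!: mult_nonneg_nonneg\<close>)
  finally show "dist (n x /\<^sub>R d x) (n y /\<^sub>R d y) \<le> (K / d0 + B * M / d0\<^sup>2) * dist x y"
    by (simp add: algebra_simps power2_eq_square)
qed

text \<open>The factor \<open>w\<close> on the left compensates for the blow-up of radial
  projections as the scales tend to 0.\<close>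

lemma radial_projection_dist:
  fixes y z e :: "'a::real_normed_vector" and v w :: real
  assumes "0 < v" "0 < w"
  shows "w * norm ((y - e) /\<^sub>R v - (z - e) /\<^sub>R w) \<le> norm (y - z) + \<bar>w - v\<bar> * norm ((y - e) /\<^sub>R v)"
proof -
  have "w *\<^sub>R ((y - e) /\<^sub>R v - (z - e) /\<^sub>R w) = (y - z) + (w - v) *\<^sub>R ((y - e) /\<^sub>R v)"
    using assms by (simp add: algebra_simps)
  then have "norm (w *\<^sub>R ((y - e) /\<^sub>R v - (z - e) /\<^sub>R w)) \<le> norm (y - z) + norm ((w - v) *\<^sub>R ((y - e) /\<^sub>R v))"
    by (metis norm_triangle_ineq)
  then show ?thesis using assms by (simp only: norm_scaleR abs_of_pos)
qed

section \<open>Gauges of convex bodies\<close>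

locale centred_body =
  fixes S :: "'a::euclidean_space set" and e :: 'a
  assumes compact: "compact S" and convex: "convex S" and interior: "e \<in> interior S"
begin

section \<open>The gauge as a real function and the attainment of its infimum\<close>

definition body_gauge :: "'a \<Rightarrow> real" where
  "body_gauge y = enn2real (set_gauge S e y)"

lemma inner_ball: obtains r where "0 < r" "cball e r \<subseteq> S"
  using interior by (auto simp: mem_interior_cball)

lemma outer_ball: obtains D where "0 < D" "\<And>x. x \<in> S \<Longrightarrow> norm (x - e) \<le> D"
proof -
  obtain a where a: "\<And>x. x \<in> S \<Longrightarrow> norm x \<le> a"
    using compact_imp_bounded[OF compact] by (auto simp: bounded_iff)
  show thesis
  proof
    show "0 < \<bar>a\<bar> + norm e + 1" by (simp add: add_nonneg_pos)
    fix x assume "x \<in> S"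
    then show "norm (x - e) \<le> \<bar>a\<bar> + norm e + 1"
      using a norm_triangle_ineq4[of x e] by fastforce
  qed
qed

lemma centre_mem: "e \<in> S"
  using interior interior_subset by blast

lemma scaled_mem_mono:
  assumes "0 < v" "v \<le> w" "e + (y - e) /\<^sub>R v \<in> S"
  shows "e + (y - e) /\<^sub>R w \<in> S"
proof -
  have "(1 - v / w) *\<^sub>R e + (v / w) *\<^sub>R (e + (y - e) /\<^sub>R v) \<in> S"
    using assms centre_mem by (intro convexD[OF convex]) auto
  also have "(1 - v / w) *\<^sub>R e + (v / w) *\<^sub>R (e + (y - e) /\<^sub>R v) = e + ((v / w) * inverse v) *\<^sub>R (y - e)"
    by (simp add: algebra_simps)
  also have "(v / w) * inverse v = inverse w" using assms by (simp add: field_simps)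
  finally show ?thesis .
qed

lemma set_gauge_centre: "set_gauge S e e = 0"
proof -
  have le: "set_gauge S e e \<le> ennreal v" if "0 < v" for v
    unfolding set_gauge_def using that centre_mem by (intro INF_lower) auto
  show ?thesis
  proof (cases "set_gauge S e e")
    case (real r)
    then have "r \<le> 0 + v" if "0 < v" for v
      using le[OF that] that by (simp add: ennreal_le_iff)
    then have "r \<le> 0" using field_le_epsilon by blast
    then show ?thesis using real by simp
  next
    case top
    then show ?thesis using le[of 1] by (simp add: top_unique)
  qed
qed

text \<open>The admissible scales form an upward closed set that is bounded below by
  \<open>norm (y - e) / D\<close> and topologically closed, so their infimum belongs to it.\<close>

lemma set_gauge_attained:
  assumes "y \<noteq> e"
  obtains g where "0 < g" "set_gauge S e y = ennreal g"
    "\<And>v. 0 < v \<Longrightarrow> e + (y - e) /\<^sub>R v \<in> S \<longleftrightarrow> g \<le> v"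
proof -
  define V where "V = {v. 0 < v \<and> e + (y - e) /\<^sub>R v \<in> S}"
  obtain r where r: "0 < r" "cball e r \<subseteq> S" by (rule inner_ball) blast
  obtain D where D: "0 < D" "\<And>x. x \<in> S \<Longrightarrow> norm (x - e) \<le> D" by (rule outer_ball) blast
  have ne: "0 < norm (y - e)" using assms by simp
  have "norm (y - e) / r \<in> V"
    using r ne by (auto simp: V_def dist_norm intro!: subsetD[OF r(2)])
  then have V_ne: "V \<noteq> {}" by blast
  have lower: "norm (y - e) / D \<le> v" if "v \<in> V" for v
    using D(2)[of "e + (y - e) /\<^sub>R v"] that D(1)
    by (simp add: V_def pos_divide_le_eq inverse_eq_divide mult.commute)
  then have bdd: "bdd_below V" by (auto simp: bdd_below_def)
  define g where "g = Inf V"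
  have g0: "0 < g"
    using ne D(1) cInf_greatest[OF V_ne lower] by (auto simp: g_def intro: less_le_trans[of 0 "norm (y - e) / D"])
  \<comment> \<open>Restricting to \<open>{g..}\<close> keeps \<open>v\<close> away from 0, where
    \<open>inverse v\<close> is discontinuous, so that a closed preimage is available.\<close>
  have "V = {v \<in> {g..}. e + (y - e) /\<^sub>R v \<in> S}"
    using g0 cInf_lower[OF _ bdd] by (auto simp: V_def g_def)
  moreover have "closed ({g..} \<inter> (\<lambda>v. e + (y - e) /\<^sub>R v) -` S)"
    using g0 compact_imp_closed[OF compact]
    by (intro continuous_closed_preimage continuous_intros) auto
  ultimately have "closed V" by (simp add: vimage_def Int_def conj_commute)
  then have gV: "g \<in> V" unfolding g_def using V_ne bdd by (rule closed_contains_Inf[rotated 2])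
  have iff: "e + (y - e) /\<^sub>R v \<in> S \<longleftrightarrow> g \<le> v" if "0 < v" for v
    using cInf_lower[OF _ bdd, of v] that gV scaled_mem_mono[of g v y] by (auto simp: V_def g_def)
  have "set_gauge S e y = ennreal g"
    unfolding set_gauge_def
  proof (rule antisym)
    show "(INF v\<in>{v. 0 < v \<and> e + (y - e) /\<^sub>R v \<in> S}. ennreal v) \<le> ennreal g"
      using gV unfolding V_def by (intro INF_lower)
    show "ennreal g \<le> (INF v\<in>{v. 0 < v \<and> e + (y - e) /\<^sub>R v \<in> S}. ennreal v)"
      using iff by (intro INF_greatest ennreal_leI) auto
  qed
  then show thesis using that g0 iff by blast
qed

lemma set_gauge_eq: "set_gauge S e y = ennreal (body_gauge y)"
proof (cases "y = e")
  case True
  then show ?thesis by (simp add: set_gauge_centre body_gauge_def)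
next
  case False
  obtain g where "0 < g" "set_gauge S e y = ennreal g" using False by (rule set_gauge_attained)
  then show ?thesis by (simp add: body_gauge_def)
qed

lemma gauge_centre [simp]: "body_gauge e = 0"
  by (simp add: body_gauge_def set_gauge_centre)

lemma gauge_nonneg [simp]: "0 \<le> body_gauge y"
  by (simp add: body_gauge_def)

lemma
  assumes "y \<noteq> e"
  shows gauge_pos: "0 < body_gauge y"
    and scaled_mem_iff: "0 < v \<Longrightarrow> e + (y - e) /\<^sub>R v \<in> S \<longleftrightarrow> body_gauge y \<le> v"
proof -
  obtain g where g: "0 < g" "set_gauge S e y = ennreal g"
    "\<And>v. 0 < v \<Longrightarrow> e + (y - e) /\<^sub>R v \<in> S \<longleftrightarrow> g \<le> v" using assms by (rule set_gauge_attained) blast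
  then have "body_gauge y = g" by (simp add: body_gauge_def)
  then show "0 < body_gauge y" "0 < v \<Longrightarrow> e + (y - e) /\<^sub>R v \<in> S \<longleftrightarrow> body_gauge y \<le> v" using g by auto
qed

lemma mem_iff_gauge_le_1: "y \<in> S \<longleftrightarrow> body_gauge y \<le> 1"
  using scaled_mem_iff[of y 1] centre_mem by (cases "y = e") auto

section \<open>Radial projection onto the boundary, and normals there\<close>

definition proj :: "'a \<Rightarrow> 'a" where
  "proj y = e + (y - e) /\<^sub>R body_gauge y"

lemma proj_mem: "y \<noteq> e \<Longrightarrow> proj y \<in> S"
  by (simp add: proj_def scaled_mem_iff gauge_pos)

text \<open>If the projection were interior, moving it slightly outward along its ray would stay in
  \<open>S\<close> and give a scale below the gauge.\<close>

lemma proj_frontier: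
  assumes y: "y \<noteq> e"
  shows "proj y \<in> frontier S"
proof -
  have "proj y \<notin> interior S"
  proof
    assume "proj y \<in> interior S"
    then obtain \<epsilon> where \<epsilon>: "0 < \<epsilon>" "cball (proj y) \<epsilon> \<subseteq> S" by (auto simp: mem_interior_cball)
    define s where "s = \<epsilon> / (norm (proj y - e) + 1)"
    have s: "0 < s" "s * norm (proj y - e) \<le> \<epsilon>"
      using \<epsilon>(1) by (auto simp: s_def add_nonneg_pos divide_le_eq mult_left_mono)
    have "proj y + s *\<^sub>R (proj y - e) \<in> S"
      using s by (intro subsetD[OF \<epsilon>(2)]) (simp add: dist_norm)
    also have "proj y + s *\<^sub>R (proj y - e) = e + (y - e) /\<^sub>R (body_gauge y / (1 + s))"
      using s gauge_pos[OF y] by (simp add: proj_def algebra_simps divide_inverse)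
    finally have "body_gauge y \<le> body_gauge y / (1 + s)"
      using scaled_mem_iff[OF y, of "body_gauge y / (1 + s)"] s gauge_pos[OF y] by simp
    moreover have "0 < s * body_gauge y" using s gauge_pos[OF y] by simp
    ultimately show False using s by (simp add: field_simps)
  qed
  then show ?thesis
    using proj_mem[OF y] closure_subset by (auto simp: frontier_def)
qed

lemma unit_normal_exists:
  assumes x: "x \<in> frontier S"
  shows "\<exists>n\<in>normal_cone S x. norm n = 1"
proof -
  have "rel_interior S = interior S"
    using interior by (intro rel_interior_nonempty_interior) auto
  then have "x \<in> closure S" "x \<notin> rel_interior S" using x by (auto simp: frontier_def)
  then obtain a where a: "a \<noteq> 0" "\<And>y. y \<in> closure S \<Longrightarrow> a \<bullet> x \<le> a \<bullet> y"
    using supporting_hyperplane_relative_frontier[OF convex] by metis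
  \<comment> \<open>The functional \<open>a\<close> attains its minimum over the body at
    \<open>x\<close>, so the outward normal is its negative.\<close>
  have "- a /\<^sub>R norm a \<in> normal_cone S x"
    unfolding normal_cone_def
  proof (intro CollectI ballI)
    fix x' assume "x' \<in> S"
    then have "a \<bullet> x \<le> a \<bullet> x'" using a(2) closure_subset by blast
    then show "(- a /\<^sub>R norm a) \<bullet> (x' - x) \<le> 0"
      using a(1) by (simp add: inner_diff_right)
  qed
  then show ?thesis using a(1) by (intro bexI[of _ "- a /\<^sub>R norm a"]) auto
qed

text \<open>A choice; at a boundary point of a \<open>smooth_set\<close> there is only one unit
  normal, as equal base points in that definition show.\<close>

definition unit_normal :: "'a \<Rightarrow> 'a" where
  "unit_normal x = (SOME n. n \<in> normal_cone S x \<and> norm n = 1)"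

text \<open>For a boundary point \<open>x\<close>, the distance from \<open>e\<close> to the
  supporting hyperplane at \<open>x\<close>.\<close>

definition support_dist :: "'a \<Rightarrow> real" where
  "support_dist x = unit_normal x \<bullet> (x - e)"

text \<open>The normal rescaled to have inner product 1 with \<open>x - e\<close>; it is a
  subgradient of the gauge along the ray from \<open>e\<close> through the boundary point
  \<open>x\<close>.\<close>

definition conormal :: "'a \<Rightarrow> 'a" where
  "conormal x = unit_normal x /\<^sub>R support_dist x"

lemma unit_normal:
  assumes "x \<in> frontier S"
  shows "unit_normal x \<in> normal_cone S x" "norm (unit_normal x) = 1"
  using someI_ex[of "\<lambda>n. n \<in> normal_cone S x \<and> norm n = 1"] unit_normal_exists[OF assms]
  by (auto simp: unit_normal_def)

text \<open>The point of the inner ball that is furthest in the normal direction lies in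
  \<open>S\<close>, hence on the inner side of the supporting hyperplane.\<close>

lemma support_dist_ge:
  assumes x: "x \<in> frontier S" and r: "0 < r" "cball e r \<subseteq> S"
  shows "r \<le> support_dist x"
proof -
  note n = unit_normal[OF x]
  have "e + r *\<^sub>R unit_normal x \<in> S"
    using r n(2) by (intro subsetD[OF r(2)]) (simp add: dist_norm)
  then have "unit_normal x \<bullet> ((e + r *\<^sub>R unit_normal x) - x) \<le> 0"
    using n(1) by (auto simp: normal_cone_def)
  moreover have "unit_normal x \<bullet> unit_normal x = 1" using n(2) by (simp add: dot_square_norm)
  ultimately show ?thesis
    by (simp add: support_dist_def inner_add_right inner_diff_right)
qed

lemma norm_conormal_le:
  assumes x: "x \<in> frontier S" and r: "0 < r" "cball e r \<subseteq> S"
  shows "norm (conormal x) \<le> 1 / r"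
  using support_dist_ge[OF assms] unit_normal[OF x] r
  by (simp add: conormal_def divide_simps)

lemma conormal_inner:
  assumes y: "y \<noteq> e"
  shows "conormal (proj y) \<bullet> (y - e) = body_gauge y"
proof -
  obtain r where r: "0 < r" "cball e r \<subseteq> S" by (rule inner_ball) blast
  have "0 < support_dist (proj y)" using support_dist_ge[OF proj_frontier[OF y] r] r by simp
  moreover have "support_dist (proj y) = (unit_normal (proj y) \<bullet> (y - e)) / body_gauge y"
    by (simp add: support_dist_def proj_def divide_inverse mult.commute)
  ultimately have "unit_normal (proj y) \<bullet> (y - e) / support_dist (proj y) = body_gauge y"
    using gauge_pos[OF y] by (auto simp: divide_eq_eq mult.commute)
  then show ?thesis by (simp add: conormal_def divide_inverse mult.commute)
qed

text \<open>\<open>proj z\<close> lies in \<open>S\<close>, hence on the inner side of the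
  supporting hyperplane at \<open>x\<close>; scaling by the gauge of \<open>z\<close> carries this
  over to \<open>z\<close>.\<close>

lemma gauge_ge_conormal:
  assumes x: "x \<in> frontier S"
  shows "conormal x \<bullet> (z - e) \<le> body_gauge z"
proof (cases "z = e")
  case False
  obtain r where r: "0 < r" "cball e r \<subseteq> S" by (rule inner_ball) blast
  have d: "0 < support_dist x" using support_dist_ge[OF x r] r by simp
  have "unit_normal x \<bullet> (proj z - x) \<le> 0"
    using unit_normal(1)[OF x] proj_mem[OF False] by (auto simp: normal_cone_def)
  then have "unit_normal x \<bullet> ((z - e) /\<^sub>R body_gauge z) \<le> support_dist x"
    by (simp add: proj_def support_dist_def inner_diff_right inner_add_right)
  then have "unit_normal x \<bullet> (z - e) / body_gauge z \<le> support_dist x"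
    by (simp add: divide_inverse mult.commute)
  then have "unit_normal x \<bullet> (z - e) / support_dist x \<le> body_gauge z"
    using d gauge_pos[OF False] by (simp add: divide_le_eq mult.commute)
  then show ?thesis by (simp add: conormal_def divide_inverse mult.commute)
qed simp

lemma gauge_subgradient:
  assumes y: "y \<noteq> e"
  shows "body_gauge y + conormal (proj y) \<bullet> (z - y) \<le> body_gauge z"
  using gauge_ge_conormal[OF proj_frontier[OF y], of z] conormal_inner[OF y]
  by (simp add: inner_diff_right)

text \<open>The subgradient inequality together with the bound \<open>1 / r\<close> on
  conormals.\<close>

lemma gauge_lipschitz:
  assumes r: "0 < r" "cball e r \<subseteq> S"
  shows "\<bar>body_gauge y - body_gauge z\<bar> \<le> norm (y - z) / r"
proof -
  have *: "body_gauge y - body_gauge z \<le> norm (y - z) / r" for y z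
  proof (cases "y = e")
    case True
    then show ?thesis using r by (simp add: order_trans[of _ 0])
  next
    case False
    have "body_gauge y - body_gauge z \<le> conormal (proj y) \<bullet> (y - z)"
      using gauge_subgradient[OF False, of z] by (simp add: inner_diff_right)
    also have "\<dots> \<le> norm (conormal (proj y)) * norm (y - z)" by (rule norm_cauchy_schwarz)
    also have "\<dots> \<le> (1 / r) * norm (y - z)"
      using norm_conormal_le[OF proj_frontier[OF False] r] by (intro mult_right_mono) auto
    finally show ?thesis by simp
  qed
  from *[of y z] *[of z y] show ?thesis by (simp add: norm_minus_commute abs_le_iff)
qed

section \<open>The squared gauge: subgradients, convexity and smoothness\<close>

definition gauge2_grad :: "'a \<Rightarrow> 'a" where
  "gauge2_grad y = (if y = e then 0 else (2 * body_gauge y) *\<^sub>R conormal (proj y))"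

text \<open>The subgradient inequality of the gauge is multiplied by
  \<open>2 * body_gauge y\<close>, and the square of \<open>body_gauge z - body_gauge y\<close> is
  nonnegative. At the centre, where the projection has no meaning, the squared gauge is minimal and
  0 is a subgradient.\<close>

lemma gauge2_subgradient: "(body_gauge y)\<^sup>2 + gauge2_grad y \<bullet> (z - y) \<le> (body_gauge z)\<^sup>2"
proof (cases "y = e")
  case False
  have "2 * body_gauge y * (conormal (proj y) \<bullet> (z - y)) \<le> 2 * body_gauge y * (body_gauge z - body_gauge y)"
    using gauge_subgradient[OF False, of z] by (intro mult_left_mono) auto
  also have "\<dots> \<le> (body_gauge z)\<^sup>2 - (body_gauge y)\<^sup>2"
    using zero_le_power2[of "body_gauge z - body_gauge y"] by (simp add: power2_eq_square algebra_simps)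
  finally show ?thesis using False by (simp add: gauge2_grad_def)
qed (simp add: gauge2_grad_def)

lemma gauge2_convex: "convex_on UNIV (\<lambda>y. (body_gauge y)\<^sup>2)"
  using gauge2_subgradient by (rule convex_on_subgradient)

text \<open>Normals are Lipschitz by \<open>smooth_set\<close>, and so is the support distance on
  the bounded boundary; the latter is at least \<open>r\<close>, so the quotient rule
  applies.\<close>

lemma conormal_lipschitz:
  assumes smooth: "smooth_set \<beta> S"
  obtains K where "K-lipschitz_on (frontier S) conormal"
proof -
  obtain r where r: "0 < r" "cball e r \<subseteq> S" by (rule inner_ball) blast
  obtain D where D: "0 < D" "\<And>x. x \<in> S \<Longrightarrow> norm (x - e) \<le> D" by (rule outer_ball) blast
  have fr: "x \<in> S" if "x \<in> frontier S" for x
    using that compact_imp_closed[OF compact] by (auto simp: frontier_def)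
  \<comment> \<open>\<open>smooth_set\<close> does not fix the sign of \<open>\<beta>\<close>; the
    absolute value provides the nonnegative constant that \<open>lipschitz_on\<close>
    demands.\<close>
  have n_le: "norm (unit_normal x - unit_normal y) \<le> \<bar>\<beta>\<bar> * norm (x - y)"
    if "x \<in> frontier S" "y \<in> frontier S" for x y
  proof -
    have "norm (unit_normal x - unit_normal y) \<le> \<beta> * norm (x - y)"
      using smooth that unit_normal unfolding smooth_set_def by blast
    also have "\<dots> \<le> \<bar>\<beta>\<bar> * norm (x - y)" by (intro mult_right_mono) auto
    finally show ?thesis .
  qed
  then have n: "\<bar>\<beta>\<bar>-lipschitz_on (frontier S) unit_normal"
    by (intro lipschitz_onI) (auto simp: dist_norm)
  have d: "(\<bar>\<beta>\<bar> * D + 1)-lipschitz_on (frontier S) support_dist"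
  proof (rule lipschitz_onI)
    fix x y assume x: "x \<in> frontier S" and y: "y \<in> frontier S"
    have "support_dist x - support_dist y
        = (unit_normal x - unit_normal y) \<bullet> (x - e) + unit_normal y \<bullet> (x - y)"
      by (simp add: support_dist_def algebra_simps)
    also have "\<bar>\<dots>\<bar> \<le> norm (unit_normal x - unit_normal y) * norm (x - e) + norm (unit_normal y) * norm (x - y)"
      by (intro order_trans[OF abs_triangle_ineq] add_mono Cauchy_Schwarz_ineq2)
    also have "\<dots> \<le> (\<bar>\<beta>\<bar> * norm (x - y)) * D + 1 * norm (x - y)"
      using n_le[OF x y] D fr[OF x] unit_normal(2)[OF y]
      by (intro add_mono mult_mono) auto
    finally show "dist (support_dist x) (support_dist y) \<le> (\<bar>\<beta>\<bar> * D + 1) * dist x y"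
      by (simp add: dist_real_def dist_norm algebra_simps)
  qed (use D in simp)
  have "(\<bar>\<beta>\<bar> / r + 1 * (\<bar>\<beta>\<bar> * D + 1) / r\<^sup>2)-lipschitz_on (frontier S) (\<lambda>x. unit_normal x /\<^sub>R support_dist x)"
    using support_dist_ge r unit_normal(2) by (intro lipschitz_on_scaleR_inverse[OF n _ d]) auto
  then have "(\<bar>\<beta>\<bar> / r + 1 * (\<bar>\<beta>\<bar> * D + 1) / r\<^sup>2)-lipschitz_on (frontier S) conormal"
    by (subst lipschitz_on_cong[OF refl refl]) (auto simp: conormal_def)
  then show thesis by (rule that)
qed

text \<open>\<open>gauge2_grad\<close> is a product of the gauge and the conormal at the projection;
  the gauge factor absorbs the blow-up of the projection near the centre.\<close>

lemma gauge2_smooth: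
  assumes smooth: "smooth_set \<beta> S"
  obtains L where "smooth_on L UNIV (\<lambda>y. (body_gauge y)\<^sup>2)"
proof -
  obtain K where K: "K-lipschitz_on (frontier S) conormal" using conormal_lipschitz[OF smooth] .
  obtain r where r: "0 < r" "cball e r \<subseteq> S" by (rule inner_ball) blast
  obtain D where D: "0 < D" "\<And>x. x \<in> S \<Longrightarrow> norm (x - e) \<le> D" by (rule outer_ball) blast
  have K0: "0 \<le> K" using K by (rule lipschitz_on_nonneg)
  define M where "M = 2 / r\<^sup>2 + 2 * K * (1 + D / r)"
  have at_centre: "norm (gauge2_grad y) \<le> M * norm (y - e)" if y: "y \<noteq> e" for y
  proof -
    have "norm (gauge2_grad y) = 2 * body_gauge y * norm (conormal (proj y))"
      using y by (simp add: gauge2_grad_def)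
    also have "\<dots> \<le> 2 * (norm (y - e) / r) * (1 / r)"
      using r gauge_lipschitz[OF r, of y e] norm_conormal_le[OF proj_frontier[OF y] r]
      by (intro mult_mono) auto
    also have "\<dots> \<le> M * norm (y - e)"
      using r K0 D by (simp add: M_def power2_eq_square algebra_simps)
    finally show ?thesis .
  qed
  have away: "norm (gauge2_grad y - gauge2_grad z) \<le> M * norm (y - z)" if y: "y \<noteq> e" and z: "z \<noteq> e" for y z
  proof -
    have px: "body_gauge z * norm (proj y - proj z) \<le> (1 + D / r) * norm (y - z)"
    proof -
      have "body_gauge z * norm (proj y - proj z) \<le> norm (y - z) + \<bar>body_gauge z - body_gauge y\<bar> * norm ((y - e) /\<^sub>R body_gauge y)"
        using radial_projection_dist[OF gauge_pos[OF y] gauge_pos[OF z], of y e z] by (simp add: proj_def)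
      also have "\<dots> \<le> norm (y - z) + (norm (y - z) / r) * D"
        using gauge_lipschitz[OF r, of z y] D(2)[OF proj_mem[OF y]] r
        by (intro add_left_mono mult_mono) (auto simp: proj_def norm_minus_commute)
      finally show ?thesis by (simp add: algebra_simps)
    qed
    \<comment> \<open>The split puts \<open>body_gauge z\<close> in front of the difference of the
      conormals, the form in which \<open>px\<close> controls it.\<close>
    have "gauge2_grad y - gauge2_grad z = (2 * (body_gauge y - body_gauge z)) *\<^sub>R conormal (proj y)
        + (2 * body_gauge z) *\<^sub>R (conormal (proj y) - conormal (proj z))"
      using y z by (simp add: gauge2_grad_def algebra_simps)
    then have "norm (gauge2_grad y - gauge2_grad z) \<le> 2 * \<bar>body_gauge y - body_gauge z\<bar> * norm (conormal (proj y))
        + 2 * body_gauge z * norm (conormal (proj y) - conormal (proj z))"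
      by (metis (no_types, lifting) norm_triangle_ineq norm_scaleR abs_mult abs_numeral gauge_nonneg abs_of_nonneg)
    also have "\<dots> \<le> 2 * (norm (y - z) / r) * (1 / r) + 2 * body_gauge z * (K * norm (proj y - proj z))"
      using gauge_lipschitz[OF r, of y z] norm_conormal_le[OF proj_frontier[OF y] r] r
        lipschitz_onD[OF K proj_frontier[OF y] proj_frontier[OF z]]
      by (intro add_mono mult_mono) (auto simp: dist_norm)
    also have "\<dots> = 2 / r\<^sup>2 * norm (y - z) + 2 * K * (body_gauge z * norm (proj y - proj z))"
      by (simp add: power2_eq_square)
    also have "\<dots> \<le> 2 / r\<^sup>2 * norm (y - z) + 2 * K * ((1 + D / r) * norm (y - z))"
      using px K0 by (intro add_left_mono mult_left_mono) auto
    finally show ?thesis by (simp add: M_def algebra_simps)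
  qed
  have "M-lipschitz_on UNIV gauge2_grad"
  proof (rule lipschitz_onI)
    fix y z
    show "dist (gauge2_grad y) (gauge2_grad z) \<le> M * dist y z"
      using at_centre[of y] at_centre[of z] away[of y z]
      by (cases "y = e"; cases "z = e") (auto simp: dist_norm gauge2_grad_def[of e] norm_minus_commute)
  qed (use r D K0 in \<open>simp add: M_def\<close>)
  then show thesis using smooth_on_subgradient[OF gauge2_subgradient] that by blast
qed

end

section \<open>Radial transforms of smooth concave functions\<close>

locale radial_objective =
  fixes f :: "'a::euclidean_space \<Rightarrow> ennreal" and e0 :: 'a and \<beta> :: real
  assumes hypo_concave: "hypo_concave f"
    and usc: "upper_semicontinuous f"
    and open_dom: "open (eff_dom f)"
    and bounded_dom: "bounded (closure (eff_dom f))"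
    and centre: "e0 \<in> interior (closure (eff_dom f))"
    and smooth: "smooth_on \<beta> (eff_dom f) (\<lambda>x. enn2real (f x))"
begin

section \<open>Finiteness, concavity and continuity of the objective\<close>

abbreviation X :: "'a set" where "X \<equiv> eff_dom f"
abbreviation F :: "'a \<Rightarrow> real" where "F \<equiv> \<lambda>x. enn2real (f x)"

text \<open>By convexity of the hypograph an infinite value at \<open>x\<close> would lift
  \<open>f\<close> beyond every bound on the segment from \<open>y\<close> towards \<open>x\<close>,
  also at points so close to \<open>y\<close> that they lie in the open domain, where
  \<open>f\<close> is finite.\<close>

lemma f_finite: "f x < \<infinity>"
proof (rule ccontr)
  assume "\<not> f x < \<infinity>"
  then have top: "f x = \<infinity>" by (simp add: less_top[symmetric])
  obtain y where y: "y \<in> X" using centre interior_subset closure_empty by fastforce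
  define z where "z = (\<lambda>t::real. (1 - t) *\<^sub>R y + t *\<^sub>R x)"
  have "(z \<longlongrightarrow> z 0) (at_right 0)"
    unfolding z_def by (intro tendsto_intros)
  then have "\<forall>\<^sub>F t in at_right 0. z t \<in> X"
    using open_dom y by (intro topological_tendstoD) (auto simp: z_def)
  moreover have "\<forall>\<^sub>F t in at_right (0::real). 0 < t \<and> t < 1"
    using eventually_at_right_real[of 0 "1::real"] by (auto elim: eventually_mono)
  ultimately have "\<forall>\<^sub>F t in at_right 0. z t \<in> X \<and> 0 < t \<and> t < 1" by (rule eventually_conj)
  then obtain t where t: "z t \<in> X" "0 < t" "t < 1"
    using eventually_happens'[OF trivial_limit_at_right_real] by blast
  \<comment> \<open>Chosen so that the share of \<open>x\<close> alone, \<open>t * u\<close>,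
    exceeds \<open>F (z t)\<close> by 1.\<close>
  define u where "u = (F (z t) + 1) / t"
  have u: "0 < u" using t by (simp add: u_def add_nonneg_pos)
  have "(y, F y) \<in> hypo f" "(x, u) \<in> hypo f"
    using y u top by (auto simp: hypo_def eff_dom_def enn2real_positive_iff)
  then have "(1 - t) *\<^sub>R (y, F y) + t *\<^sub>R (x, u) \<in> hypo f"
    using hypo_concave t unfolding hypo_concave_def by (intro convexD) auto
  then have "ennreal ((1 - t) * F y + t * u) \<le> f (z t)" "0 < (1 - t) * F y + t * u"
    by (auto simp: hypo_def z_def)
  moreover have "f (z t) = ennreal (F (z t))" using t(1) by (simp add: eff_dom_def)
  ultimately have "(1 - t) * F y + t * u \<le> F (z t)" by (metis ennreal_le_iff enn2real_nonneg)
  moreover have "t * u = F (z t) + 1" using t by (simp add: u_def)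
  moreover have "0 \<le> (1 - t) * F y" using t by simp
  ultimately show False by linarith
qed

lemma f_eq: "f x = ennreal (F x)"
  using f_finite[of x] by simp

lemma mem_dom_iff: "x \<in> X \<longleftrightarrow> 0 < F x"
  using f_finite[of x] by (auto simp: eff_dom_def enn2real_positive_iff)

lemma F_pos_of_nonzero: "F x \<noteq> 0 \<Longrightarrow> 0 < F x"
  by (metis enn2real_nonneg less_eq_real_def)

lemma F_concave: "concave_on X F"
  and convex_dom: "convex X"
proof -
  have *: "u * F x + v * F y \<le> F (u *\<^sub>R x + v *\<^sub>R y) \<and> u *\<^sub>R x + v *\<^sub>R y \<in> X"
    if x: "x \<in> X" and y: "y \<in> X" and uv: "0 \<le> u" "0 \<le> v" "u + v = 1" for x y u v
  proof -
    have "(x, F x) \<in> hypo f" "(y, F y) \<in> hypo f"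
      using x y f_eq by (auto simp: hypo_def mem_dom_iff)
    then have "u *\<^sub>R (x, F x) + v *\<^sub>R (y, F y) \<in> hypo f"
      using hypo_concave uv unfolding hypo_concave_def by (intro convexD) auto
    then have "0 < u * F x + v * F y" "ennreal (u * F x + v * F y) \<le> ennreal (F (u *\<^sub>R x + v *\<^sub>R y))"
      using f_eq[of "u *\<^sub>R x + v *\<^sub>R y"] by (auto simp: hypo_def)
    then show ?thesis by (simp add: ennreal_le_iff mem_dom_iff)
  qed
  then show "convex X" by (auto simp: convex_def)
  then show "concave_on X F" using * by (auto simp: concave_on_iff)
qed

lemma F_GDERIV: "x \<in> X \<Longrightarrow> GDERIV F x :> grad F x"
  using smooth by (intro GDERIV_grad) (auto simp: smooth_on_def)

text \<open>On the domain this is differentiability. Off it \<open>F\<close> vanishes, so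
  nonnegativity gives one half of continuity and upper semicontinuity the other.\<close>

lemma F_continuous: "continuous_on UNIV F"
proof -
  have "isCont F x" for x
  proof (cases "x \<in> X")
    case True
    then show ?thesis using smooth by (auto simp: smooth_on_def intro: differentiable_imp_continuous_within)
  next
    case False
    then have 0: "F x = 0" using mem_dom_iff[of x] by (simp add: order_antisym not_less)
    have "\<forall>\<^sub>F y in at x. dist (F y) (F x) < r" if r: "0 < r" for r
    proof -
      have "closed {y. ennreal r \<le> f y}" using usc by (simp add: upper_semicontinuous_def)
      moreover have "{y. ennreal r \<le> f y} = {y. r \<le> F y}"
      proof -
        have "ennreal r \<le> f y \<longleftrightarrow> r \<le> F y" for y by (subst f_eq) (simp add: ennreal_le_iff)
        then show ?thesis by blast
      qed
      ultimately have "open (- {y. r \<le> F y})" by auto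
      moreover have "x \<in> - {y. r \<le> F y}" using 0 r by simp
      ultimately have "\<forall>\<^sub>F y in at x. y \<in> - {y. r \<le> F y}" by (rule eventually_at_in_open')
      then show ?thesis using 0 by (auto simp: dist_real_def elim: eventually_mono)
    qed
    then show ?thesis unfolding isCont_def by (intro tendstoI) auto
  qed
  then show ?thesis by (simp add: continuous_on_eq_continuous_at)
qed

text \<open>An open convex set is the interior of its closure.\<close>

lemma centre_mem: "e0 \<in> X"
  using centre open_dom convex_dom by (simp add: convex_interior_closure interior_open)

lemma F_centre_pos: "0 < F e0"
  using centre_mem mem_dom_iff by blast

section \<open>The perspective of the objective and the bound by the inner radius\<close>

definition pt :: "'a \<Rightarrow> real \<Rightarrow> 'a" where
  "pt y v = e0 + (y - e0) /\<^sub>R v"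

lemma pt_1 [simp]: "pt y 1 = y"
  by (simp add: pt_def)

text \<open>\<open>pt y w\<close> is the convex combination of \<open>pt y v\<close> and
  \<open>e0\<close> with weight \<open>v / w\<close> on the former. So the perspective
  \<open>v * F (pt y v)\<close> grows in \<open>v\<close> at rate at least \<open>F e0\<close> once
  it is positive.\<close>

lemma perspective_mono:
  assumes v: "0 < v" "v \<le> w" and pos: "0 < F (pt y v)"
  shows "v * F (pt y v) + (w - v) * F e0 \<le> w * F (pt y w)"
proof -
  have "(v / w) * F (pt y v) + (1 - v / w) * F e0 \<le> F ((v / w) *\<^sub>R pt y v + (1 - v / w) *\<^sub>R e0)"
    using v pos centre_mem by (intro concave_on_combination[OF F_concave]) (auto simp: mem_dom_iff)
  also have "(v / w) *\<^sub>R pt y v + (1 - v / w) *\<^sub>R e0 = e0 + ((v / w) * inverse v) *\<^sub>R (y - e0)"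
    by (simp add: pt_def algebra_simps)
  also have "(v / w) * inverse v = inverse w" using v by (simp add: field_simps)
  finally have "w * ((v / w) * F (pt y v) + (1 - v / w) * F e0) \<le> w * F (pt y w)"
    using v by (intro mult_left_mono) (auto simp: pt_def)
  then show ?thesis using v by (simp add: algebra_simps)
qed

text \<open>\<open>e0\<close> lies between \<open>x\<close> and a point \<open>z\<close> of the
  domain at distance \<open>r\<close> on the opposite side; concavity with
  \<open>F z \<ge> 0\<close> bounds \<open>F x\<close>, and then \<open>r\<close> tends to the inner
  radius.\<close>

lemma inner_radius_le:
  assumes x: "x \<in> X"
  shows "inner_radius e0 (closure X) / (diameter (closure X) + inner_radius e0 (closure X)) * F x \<le> F e0"
    (is "?R / (?D + ?R) * _ \<le> _")
proof (cases "0 < ?R")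
  case True
  have D: "norm (x - e0) \<le> ?D"
    using diameter_bounded_bound[OF bounded_dom, of x e0] x centre_mem closure_subset
    by (auto simp: dist_norm)
  have "ball e0 ?R \<subseteq> closure X"
  proof
    fix z assume z: "z \<in> ball e0 ?R"
    show "z \<in> closure X"
    proof (rule ccontr)
      assume "z \<notin> closure X"
      then have "?R \<le> norm (z - e0)"
        unfolding inner_radius_def by (intro cINF_lower bdd_belowI[of _ 0]) auto
      then show False using z by (simp add: dist_norm norm_minus_commute)
    qed
  qed
  then have ball: "ball e0 ?R \<subseteq> X"
    using interior_maximal[of "ball e0 ?R" "closure X"] open_dom convex_dom
    by (simp add: convex_interior_closure interior_open)
  show ?thesis
  proof (cases "x = e0")
    case True
    have "0 \<le> ?D" using D norm_ge_zero order_trans by blast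
    then show ?thesis using True \<open>0 < ?R\<close> F_centre_pos by (simp add: divide_simps)
  next
    case False
    then have n: "0 < norm (x - e0)" by simp
    \<comment> \<open>The radius \<open>r\<close> stays strictly below \<open>?R\<close> because
      only the open ball is known to lie in the domain.\<close>
    have *: "r * F x \<le> (?D + r) * F e0" if r: "0 < r" "r < ?R" for r
    proof -
      define z where "z = e0 - (r / norm (x - e0)) *\<^sub>R (x - e0)"
      have z: "z \<in> X" using r n by (intro subsetD[OF ball]) (simp add: z_def dist_norm)
      \<comment> \<open>The weight for which the combination of \<open>x\<close> and
        \<open>z\<close> is \<open>e0\<close>.\<close>
      define s where "s = r / (norm (x - e0) + r)"
      have s: "0 \<le> s" "s \<le> 1" using r n by (auto simp: s_def add_pos_pos)
      have "s * F x + (1 - s) * F z \<le> F (s *\<^sub>R x + (1 - s) *\<^sub>R z)"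
        using F_concave x z s unfolding concave_on_iff by auto
      also have "s *\<^sub>R x + (1 - s) *\<^sub>R z = e0 + (s - (1 - s) * (r / norm (x - e0))) *\<^sub>R (x - e0)"
        by (simp add: z_def algebra_simps)
      also have "s - (1 - s) * (r / norm (x - e0)) = 0"
      proof -
        have "a \<noteq> 0 \<Longrightarrow> a + r \<noteq> 0 \<Longrightarrow> r / (a + r) - (1 - r / (a + r)) * (r / a) = 0" for a :: real
          by (simp add: field_simps)
        from this[of "norm (x - e0)"] show ?thesis using r n unfolding s_def by linarith
      qed
      finally have "s * F x + (1 - s) * F z \<le> F e0" by simp
      moreover have "0 \<le> (1 - s) * F z" using s by simp
      ultimately have "s * F x \<le> F e0" by linarith
      then have "r * F x \<le> (norm (x - e0) + r) * F e0"
        using r n by (simp add: s_def field_simps)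
      also have "\<dots> \<le> (?D + r) * F e0" using D by (intro mult_right_mono) auto
      finally show ?thesis .
    qed
    have "((\<lambda>r. r * F x) \<longlongrightarrow> ?R * F x) (at_left ?R)"
      "((\<lambda>r. (?D + r) * F e0) \<longlongrightarrow> (?D + ?R) * F e0) (at_left ?R)"
      by (intro tendsto_intros)+
    moreover have "\<forall>\<^sub>F r in at_left ?R. r * F x \<le> (?D + r) * F e0"
      using eventually_at_left_real[OF \<open>0 < ?R\<close>] by (rule eventually_mono) (use * in auto)
    ultimately have "?R * F x \<le> (?D + ?R) * F e0"
      by (intro tendsto_le[OF trivial_limit_at_left_real])
    moreover have "0 < ?D + ?R" using D n True by linarith
    ultimately show ?thesis by (simp add: divide_simps mult.commute)
  qed
next
  case False
  \<comment> \<open>An infimum of norms over a nonempty set; in this case the inner radius is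
    therefore 0 and the claim trivial.\<close>
  have "0 \<le> ?R" unfolding inner_radius_def
  proof (rule cINF_greatest)
    show "- closure X \<noteq> {}" using bounded_dom not_bounded_UNIV by (metis Compl_UNIV_eq double_complement)
  qed simp
  then show ?thesis using False F_centre_pos by simp
qed

lemma F_bounded: obtains B where "0 < B" "\<And>x. F x \<le> B"
proof -
  have "compact (closure X)" using bounded_dom by (simp add: compact_eq_bounded_closed)
  then have "bounded (F ` closure X)"
    by (intro compact_imp_bounded compact_continuous_image continuous_on_subset[OF F_continuous]) auto
  then obtain B where B: "\<And>x. x \<in> closure X \<Longrightarrow> F x \<le> B"
    by (auto simp: bounded_iff)
  have "F x \<le> \<bar>B\<bar> + 1" for x
    using B[of x] mem_dom_iff[of x] closure_subset[of X] by (cases "x \<in> X") fastforce+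
  then show thesis by (intro that[of "\<bar>B\<bar> + 1"]) auto
qed

section \<open>The radial transform as a root, and bounds on it\<close>

definition rad :: "real \<Rightarrow> 'a \<Rightarrow> real" where
  "rad \<tau> y = enn2real (radial_transform (\<lambda>x. ennreal \<tau> * f x) e0 y)"

text \<open>The perspective increases while positive, so the supremum defining the transform runs
  over exactly the scales up to the root \<open>v\<close>. The root exists by the intermediate value
  theorem between \<open>a\<close> and \<open>b\<close>.\<close>

lemma radial_root:
  assumes \<tau>: "0 < \<tau>"
  obtains v where "0 < v" "\<tau> * (v * F (pt y v)) = 1"
    "radial_transform (\<lambda>x. ennreal \<tau> * f x) e0 y = ennreal v"
proof -
  obtain B where B: "0 < B" "\<And>x. F x \<le> B" by (rule F_bounded) blast
  \<comment> \<open>At this scale the bound \<open>B\<close> on \<open>F\<close> keeps the left side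
    at most 1.\<close>
  define a where "a = 1 / (\<tau> * B)"
  have a: "0 < a" "\<tau> * (a * F (pt y a)) \<le> 1"
    using \<tau> B by (auto simp: a_def divide_simps)
  \<comment> \<open>For large \<open>v\<close> the point \<open>pt y v\<close> is near
    \<open>e0\<close> and its value exceeds \<open>F e0 / 2\<close>; a scale of at least
    \<open>2 / (\<tau> * F e0)\<close> then brings the left side up to 1.\<close>
  have "((\<lambda>v. pt y v) \<longlongrightarrow> e0 + 0 *\<^sub>R (y - e0)) at_top"
    unfolding pt_def by (intro tendsto_intros tendsto_inverse_0_at_top filterlim_ident)
  then have "((\<lambda>v. pt y v) \<longlongrightarrow> e0) at_top" by simp
  moreover have "isCont F e0" using F_continuous by (simp add: continuous_on_eq_continuous_at)
  ultimately have "((\<lambda>v. F (pt y v)) \<longlongrightarrow> F e0) at_top" by (rule isCont_tendsto_compose[rotated])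
  then have "\<forall>\<^sub>F v in at_top. F e0 / 2 < F (pt y v)"
    using F_centre_pos by (intro order_tendstoD) auto
  moreover have "\<forall>\<^sub>F v in at_top. a \<le> v" "\<forall>\<^sub>F v in at_top. 2 / (\<tau> * F e0) \<le> v"
    by (rule eventually_ge_at_top)+
  ultimately have "\<forall>\<^sub>F v in at_top. F e0 / 2 < F (pt y v) \<and> a \<le> v \<and> 2 / (\<tau> * F e0) \<le> v"
    by (intro eventually_conj)
  then obtain b where b: "F e0 / 2 < F (pt y b)" "a \<le> b" "2 / (\<tau> * F e0) \<le> b"
    using eventually_happens'[OF trivial_limit_at_top_linorder] by blast
  have "1 = \<tau> * (2 / (\<tau> * F e0) * (F e0 / 2))" using \<tau> F_centre_pos by simp
  also have "\<dots> \<le> \<tau> * (b * F (pt y b))"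
    using b a \<tau> F_centre_pos by (intro mult_left_mono mult_mono) auto
  finally have b1: "1 \<le> \<tau> * (b * F (pt y b))" .
  have "continuous_on {a..b} (\<lambda>v. \<tau> * (v * F (pt y v)))"
    unfolding pt_def using a
    by (intro continuous_intros continuous_on_compose2[OF F_continuous]) auto
  then obtain v where v: "a \<le> v" "v \<le> b" "\<tau> * (v * F (pt y v)) = 1"
    using IVT'[of "\<lambda>v. \<tau> * (v * F (pt y v))" a 1 b] a b b1 by auto
  have v0: "0 < v" using v a by linarith
  \<comment> \<open>\<open>perspective_mono\<close> excludes the scales above the root and admits
    those below it; where \<open>F\<close> vanishes the constraint is trivially met.\<close>
  have iff: "w \<in> {w. 0 < w \<and> ennreal w * (ennreal \<tau> * f (e0 + (y - e0) /\<^sub>R w)) \<le> 1} \<longleftrightarrow> 0 < w \<and> w \<le> v" for w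
  proof -
    have "ennreal w * (ennreal \<tau> * f (pt y w)) \<le> 1 \<longleftrightarrow> \<tau> * (w * F (pt y w)) \<le> 1" if "0 < w"
      using that \<tau> by (subst f_eq) (simp flip: ennreal_mult ennreal_1 add: ennreal_le_iff mult.left_commute)
    moreover have "\<tau> * (w * F (pt y w)) \<le> 1 \<longleftrightarrow> w \<le> v" if w: "0 < w"
    proof
      assume le: "\<tau> * (w * F (pt y w)) \<le> 1"
      show "w \<le> v"
      proof (rule ccontr)
        assume "\<not> w \<le> v"
        then have "v * F (pt y v) + (w - v) * F e0 \<le> w * F (pt y w)" "0 < (w - v) * F e0"
          using v v0 F_centre_pos \<tau>
          by (auto intro!: perspective_mono F_pos_of_nonzero simp del: enn2real_positive_iff)
        then have "\<tau> * (v * F (pt y v)) < \<tau> * (w * F (pt y w))" using \<tau> by simp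
        then show False using v le by simp
      qed
    next
      assume le: "w \<le> v"
      show "\<tau> * (w * F (pt y w)) \<le> 1"
      proof (cases "0 < F (pt y w)")
        case True
        then have "w * F (pt y w) \<le> v * F (pt y v)"
          using perspective_mono[OF w le True] mult_nonneg_nonneg[of "v - w" "F e0"] le F_centre_pos by linarith
        then have "\<tau> * (w * F (pt y w)) \<le> \<tau> * (v * F (pt y v))" using \<tau> by (intro mult_left_mono) auto
        then show ?thesis using v by simp
      next
        case False
        then have "F (pt y w) = 0" by (simp add: order_antisym not_less)
        then show ?thesis by simp
      qed
    qed
    ultimately show ?thesis by (auto simp: pt_def)
  qed
  have "radial_transform (\<lambda>x. ennreal \<tau> * f x) e0 y = ennreal v"
    unfolding radial_transform_def
  proof (rule antisym)
    show "(SUP w\<in>{w. 0 < w \<and> ennreal w * (ennreal \<tau> * f (e0 + (y - e0) /\<^sub>R w)) \<le> 1}. ennreal w) \<le> ennreal v"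
      using iff by (intro SUP_least ennreal_leI) blast
    show "ennreal v \<le> (SUP w\<in>{w. 0 < w \<and> ennreal w * (ennreal \<tau> * f (e0 + (y - e0) /\<^sub>R w)) \<le> 1}. ennreal w)"
      using iff v0 by (intro SUP_upper) blast
  qed
  then show thesis using that v0 v by blast
qed

lemma
  assumes "0 < \<tau>"
  shows rad_pos: "0 < rad \<tau> y"
    and rad_root: "\<tau> * (rad \<tau> y * F (pt y (rad \<tau> y))) = 1"
proof -
  obtain v where v: "0 < v" "\<tau> * (v * F (pt y v)) = 1"
    "radial_transform (\<lambda>x. ennreal \<tau> * f x) e0 y = ennreal v" using assms by (rule radial_root)
  then have "rad \<tau> y = v" by (simp add: rad_def)
  then show "0 < rad \<tau> y" "\<tau> * (rad \<tau> y * F (pt y (rad \<tau> y))) = 1" using v by auto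
qed

lemma F_pt_rad_pos: "0 < \<tau> \<Longrightarrow> 0 < F (pt y (rad \<tau> y))"
  using rad_root[of \<tau> y] by (intro F_pos_of_nonzero) auto

lemma rad_le:
  assumes \<tau>: "0 < \<tau>" and u: "0 < u" and ge: "1 \<le> \<tau> * (u * F (pt y u))"
  shows "rad \<tau> y \<le> u"
proof (rule ccontr)
  assume *: "\<not> rad \<tau> y \<le> u"
  have "0 < F (pt y u)" using ge by (intro F_pos_of_nonzero) auto
  then have "u * F (pt y u) + (rad \<tau> y - u) * F e0 \<le> rad \<tau> y * F (pt y (rad \<tau> y))"
    using * u by (intro perspective_mono) auto
  moreover have "0 < (rad \<tau> y - u) * F e0" using * F_centre_pos by simp
  ultimately have "\<tau> * (u * F (pt y u)) < \<tau> * (rad \<tau> y * F (pt y (rad \<tau> y)))" using \<tau> by simp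
  then show False using rad_root[OF \<tau>, of y] ge by simp
qed

text \<open>From the root up to scale 1 the perspective gains at least
  \<open>(1 - rad \<tau> y) * F e0\<close>.\<close>

lemma rad_le_imp_F_ge:
  assumes \<tau>: "0 < \<tau>" and le: "rad \<tau> y \<le> 1"
  shows "1 + (1 - rad \<tau> y) * (\<tau> * F e0) \<le> \<tau> * F y"
proof -
  have "rad \<tau> y * F (pt y (rad \<tau> y)) + (1 - rad \<tau> y) * F e0 \<le> 1 * F (pt y 1)"
    using le \<tau> F_pt_rad_pos rad_pos by (intro perspective_mono) auto
  then have "\<tau> * (rad \<tau> y * F (pt y (rad \<tau> y)) + (1 - rad \<tau> y) * F e0) \<le> \<tau> * F y"
    using \<tau> by (intro mult_left_mono) auto
  then show ?thesis using rad_root[OF \<tau>, of y] by (simp only: distrib_left mult.left_commute)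
qed

text \<open>From scale 1 up to \<open>?w\<close> the gain contributed by \<open>e0\<close> alone is
  \<open>1 / \<tau>\<close>, however small \<open>F x\<close> is.\<close>

lemma rad_dom_le:
  assumes \<tau>: "0 < \<tau>" and x: "x \<in> X"
  shows "rad \<tau> x \<le> 1 + 1 / (\<tau> * F e0)"
proof (rule rad_le[OF \<tau>])
  let ?w = "1 + 1 / (\<tau> * F e0)"
  show "0 < ?w" using \<tau> F_centre_pos by (simp add: add_pos_pos)
  have "1 * F (pt x 1) + (?w - 1) * F e0 \<le> ?w * F (pt x ?w)"
    using \<tau> F_centre_pos x by (intro perspective_mono) (auto simp: mem_dom_iff)
  then have "\<tau> * ((?w - 1) * F e0) \<le> \<tau> * (?w * F (pt x ?w))"
    using \<tau> by (intro mult_left_mono) (auto intro: order_trans[rotated])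
  then show "1 \<le> \<tau> * (?w * F (pt x ?w))" using \<tau> F_centre_pos by simp
qed

text \<open>The nonnegative term \<open>s * F z\<close> is dropped before continuity moves
  \<open>z\<close> to the closure. The gauge of the closed set in the definition of
  \<open>\<eta>\<close> calls for such endpoints.\<close>

lemma F_concave_closure:
  assumes x: "x \<in> X" and z: "z \<in> closure X" and s: "0 \<le> s" "s \<le> 1"
  shows "(1 - s) * F x \<le> F ((1 - s) *\<^sub>R x + s *\<^sub>R z)"
proof (rule continuous_ge_on_closure[OF _ z])
  show "continuous_on (closure X) (\<lambda>z. F ((1 - s) *\<^sub>R x + s *\<^sub>R z))"
    by (intro continuous_on_compose2[OF F_continuous] continuous_intros) auto
  fix z assume "z \<in> X"
  then have "(1 - s) * F x + s * F z \<le> F ((1 - s) *\<^sub>R x + s *\<^sub>R z)"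
    using F_concave x s unfolding concave_on_iff by auto
  then show "(1 - s) * F x \<le> F ((1 - s) *\<^sub>R x + s *\<^sub>R z)"
    using mult_nonneg_nonneg[OF s(1) enn2real_nonneg[of "f z"]] by linarith
qed

text \<open>Openness of the domain leaves room to push \<open>x\<close> outward, to
  \<open>pt x v\<close> for some \<open>v < 1\<close>.\<close>

lemma set_gauge_dom_less_1:
  assumes x: "x \<in> X"
  shows "set_gauge (closure X) e0 x < 1"
proof -
  have "continuous (at_left 1) (\<lambda>v. pt x v)"
    unfolding pt_def by (intro continuous_intros) auto
  then have "((\<lambda>v. pt x v) \<longlongrightarrow> pt x 1) (at_left 1)" by (simp add: continuous_within)
  then have "\<forall>\<^sub>F v in at_left 1. pt x v \<in> X"
    using open_dom x by (intro topological_tendstoD) auto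
  moreover have "\<forall>\<^sub>F v in at_left (1::real). v \<in> {0<..<1}" by (rule eventually_at_left_real) simp
  ultimately have "\<forall>\<^sub>F v in at_left 1. pt x v \<in> X \<and> v \<in> {0<..<1}" by (rule eventually_conj)
  then obtain v where v: "pt x v \<in> X" "0 < v" "v < 1"
    using eventually_happens'[OF trivial_limit_at_left_real] by fastforce
  have "set_gauge (closure X) e0 x \<le> ennreal v"
    unfolding set_gauge_def using v closure_subset by (intro INF_lower) (auto simp: pt_def)
  also have "\<dots> < 1" using v by (simp add: ennreal_less_one_iff)
  finally show ?thesis .
qed

text \<open>Every scale \<open>v\<close> admissible for the gauge gives the bound
  \<open>v + (1 - v) * \<theta>\<close> with \<open>\<theta> = 1 / (\<tau> * F x)\<close>; passing
  to the infimum over \<open>v\<close> gives the claim.\<close>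

lemma rad_le_set_gauge:
  assumes \<tau>: "0 < \<tau>" and x: "x \<in> X" and opt: "1 \<le> \<tau> * F x"
  defines "\<gamma> \<equiv> enn2real (set_gauge (closure X) e0 x)"
  shows "rad \<tau> x \<le> 1 - (1 - \<gamma>) * (1 - 1 / (\<tau> * F x))"
proof -
  define \<theta> where "\<theta> = 1 / (\<tau> * F x)"
  have \<theta>: "0 < \<theta>" "\<theta> \<le> 1" using opt \<tau> x by (auto simp: \<theta>_def mem_dom_iff divide_simps)
  have le1: "rad \<tau> x \<le> 1" using rad_le[OF \<tau>, of 1 x] opt by simp
  have bound: "rad \<tau> x \<le> v + (1 - v) * \<theta>" if v: "0 < v" "pt x v \<in> closure X" for v
  proof (cases "v < 1")
    case False
    have "0 \<le> (v - 1) * (1 - \<theta>)" using False \<theta> by simp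
    then show ?thesis using le1 by (simp add: algebra_simps)
  next
    case True
    \<comment> \<open>\<open>pt x u\<close> divides the segment from \<open>x\<close> to
      \<open>pt x v\<close> in the ratio given by \<open>s\<close> below. Concavity leaves at least
      \<open>(1 - s) * F x\<close> there, and \<open>u\<close> is chosen to make
      \<open>u * (1 - s) = \<theta>\<close>, which is what \<open>rad_le\<close> needs.\<close>
    define u where "u = v + (1 - v) * \<theta>"
    have u: "0 < u" "v \<le> u" "u \<le> 1"
    proof -
      have "0 \<le> (1 - v) * \<theta>" "(1 - v) * \<theta> \<le> (1 - v) * 1"
        using True \<theta> by (auto intro!: mult_left_mono)
      then show "0 < u" "v \<le> u" "u \<le> 1" using v by (auto simp only: u_def mult_1_right)
    qed
    define s where "s = (1 / u - 1) * v / (1 - v)"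
    have s: "0 \<le> s" "s \<le> 1" "u * (1 - s) = \<theta>"
    proof -
      show "0 \<le> s" using u v True by (simp add: s_def)
      have "u * (1 - s) = (u - v) / (1 - v)" using u True by (simp add: s_def field_simps)
      then show eq: "u * (1 - s) = \<theta>" using True by (simp add: u_def)
      then have "0 < 1 - s" using \<theta> u zero_less_mult_pos by metis
      then show "s \<le> 1" by simp
    qed
    have "(1 - s) * F x \<le> F ((1 - s) *\<^sub>R x + s *\<^sub>R pt x v)"
      using x v s by (intro F_concave_closure) auto
    also have "(1 - s) *\<^sub>R x + s *\<^sub>R pt x v = e0 + (1 - s + s * inverse v) *\<^sub>R (x - e0)"
      by (simp add: pt_def algebra_simps)
    also have "1 - s + s * inverse v = inverse u"
    proof -
      have "s * (1 - v) = (1 / u - 1) * v" using True by (simp add: s_def)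
      then have "s * (1 - v) / v = 1 / u - 1" using v by (simp add: field_simps)
      then show ?thesis using v by (simp add: field_simps)
    qed
    finally have "\<tau> * (u * ((1 - s) * F x)) \<le> \<tau> * (u * F (pt x u))"
      using u \<tau> by (intro mult_left_mono) (auto simp: pt_def)
    moreover have "\<tau> * (u * ((1 - s) * F x)) = \<tau> * F x * (u * (1 - s))" by simp
    moreover have "\<tau> * F x * \<theta> = 1" using \<tau> x by (simp add: \<theta>_def mem_dom_iff)
    ultimately have "1 \<le> \<tau> * (u * F (pt x u))" using s by simp
    then show ?thesis using rad_le[OF \<tau> u(1)] by (simp add: u_def)
  qed
  \<comment> \<open>The bound is solved for \<open>v\<close> by dividing by
    \<open>1 - \<theta>\<close>, so \<open>\<theta> = 1\<close> is treated apart.\<close>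
  show ?thesis
  proof (cases "\<theta> = 1")
    case True
    then show ?thesis using le1 by (simp add: \<theta>_def)
  next
    case False
    then have \<theta>1: "0 < 1 - \<theta>" using \<theta> by simp
    have "ennreal ((rad \<tau> x - \<theta>) / (1 - \<theta>)) \<le> set_gauge (closure X) e0 x"
      unfolding set_gauge_def
    proof (intro INF_greatest ennreal_leI)
      fix v assume "v \<in> {v. 0 < v \<and> e0 + (x - e0) /\<^sub>R v \<in> closure X}"
      then have "rad \<tau> x \<le> v + (1 - v) * \<theta>" by (intro bound) (auto simp: pt_def)
      then show "(rad \<tau> x - \<theta>) / (1 - \<theta>) \<le> v" using \<theta>1 by (simp add: divide_le_eq algebra_simps)
    qed
    also have "\<dots> = ennreal \<gamma>"
      unfolding \<gamma>_def using set_gauge_dom_less_1[OF x] by (intro ennreal_enn2real[symmetric]) (auto intro: less_trans)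
    finally have "(rad \<tau> x - \<theta>) / (1 - \<theta>) \<le> \<gamma>" by (simp add: ennreal_le_iff \<gamma>_def)
    then show ?thesis using \<theta>1 by (simp add: divide_le_eq algebra_simps flip: \<theta>_def)
  qed
qed

section \<open>Gradients of the radial transform and its smoothness\<close>

definition rad_denom :: "'a \<Rightarrow> real" where
  "rad_denom x = F x - grad F x \<bullet> (x - e0)"

text \<open>Implicit differentiation of the root equation
  \<open>\<tau> * (v * F (pt y v)) = 1\<close> yields this formula at \<open>x = pt y v\<close>. The
  denominator is the value at \<open>e0\<close> of the linearization of \<open>F\<close> at
  \<open>x\<close>.\<close>

definition rad_grad :: "'a \<Rightarrow> 'a" where
  "rad_grad x = (- grad F x) /\<^sub>R rad_denom x"

lemma rad_denom_ge: "x \<in> X \<Longrightarrow> F e0 \<le> rad_denom x"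
  using concave_on_gradient_le[OF F_concave F_GDERIV _ centre_mem, of x]
  by (simp add: rad_denom_def inner_diff_right)

text \<open>The supergradient inequality of \<open>f\<close> at \<open>pt y (rad \<tau> y)\<close>, evaluated at \<open>pt z (rad \<tau> z)\<close> and
  multiplied by \<open>rad \<tau> z\<close>; the values of the perspective of \<open>f\<close> at both points are \<open>1 / \<tau>\<close>.\<close>

lemma rad_subgradient:
  assumes \<tau>: "0 < \<tau>"
  shows "rad \<tau> y + rad_grad (pt y (rad \<tau> y)) \<bullet> (z - y) \<le> rad \<tau> z"
proof -
  define v w where "v = rad \<tau> y" and "w = rad \<tau> z"
  define x p where "x = pt y v" and "p = pt z w"
  define g d where "g = grad F x" and "d = rad_denom x"
  have v: "0 < v" and w: "0 < w" using \<tau> by (auto simp: v_def w_def rad_pos)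
  have x: "x \<in> X" and p: "p \<in> X" using \<tau> by (auto simp: x_def p_def v_def w_def mem_dom_iff F_pt_rad_pos)
  have d: "0 < d" using rad_denom_ge[OF x] F_centre_pos by (simp add: d_def)
  have "\<tau> * (v * F x) = \<tau> * (w * F p)"
    using rad_root[OF \<tau>, of y] rad_root[OF \<tau>, of z] by (simp add: v_def w_def x_def p_def)
  then have eq: "v * F x = w * F p" using \<tau> by simp
  have vx: "v *\<^sub>R (x - e0) = y - e0" and wp: "w *\<^sub>R (p - e0) = z - e0"
    using v w by (auto simp: x_def p_def pt_def)
  have "F p \<le> F x + g \<bullet> (p - x)"
    unfolding g_def using F_concave F_GDERIV[OF x] x p by (rule concave_on_gradient_le)
  also have "\<dots> = d + g \<bullet> (p - e0)" by (simp add: d_def rad_denom_def g_def inner_diff_right)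
  finally have "w * F p \<le> w * (d + g \<bullet> (p - e0))" using w by (intro mult_left_mono) auto
  also have "\<dots> = w * d + g \<bullet> (z - e0)" unfolding wp[symmetric] by (simp add: algebra_simps)
  finally have 1: "w * F p \<le> w * d + g \<bullet> (z - e0)" .
  have "v * F x = v * d + g \<bullet> (v *\<^sub>R (x - e0))"
    by (simp add: d_def rad_denom_def g_def algebra_simps)
  then have "v * d - g \<bullet> (z - y) \<le> w * d" using 1 eq vx by (simp add: inner_diff_right)
  then have "v - (g \<bullet> (z - y)) / d \<le> w" using d by (simp add: field_simps)
  then show ?thesis
    by (simp add: rad_grad_def v_def w_def x_def g_def d_def divide_inverse mult.commute)
qed

lemma rad_convex: "0 < \<tau> \<Longrightarrow> convex_on UNIV (rad \<tau>)"
  using rad_subgradient by (rule convex_on_subgradient)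

lemma dom_bound: obtains D where "0 < D" "\<And>x. x \<in> X \<Longrightarrow> norm (x - e0) \<le> D"
proof -
  have "norm (x - e0) \<le> diameter (closure X) + 1" if "x \<in> X" for x
    using diameter_bounded_bound[OF bounded_dom, of x e0] that centre_mem closure_subset
    by (fastforce simp: dist_norm)
  moreover have "0 < diameter (closure X) + 1" using diameter_ge_0[OF bounded_dom] by simp
  ultimately show thesis by (rule that[rotated])
qed

text \<open>On the bounded domain the Lipschitz gradient is bounded, and the supergradient
  inequality then makes \<open>F\<close> Lipschitz. So numerator and denominator of
  \<open>rad_grad\<close> are Lipschitz, the denominator is at least \<open>F e0\<close>, and the
  quotient rule applies.\<close>

lemma rad_grad_lipschitz:
  obtains K M where "K-lipschitz_on X rad_grad" "0 \<le> M" "\<And>x. x \<in> X \<Longrightarrow> norm (rad_grad x) \<le> M"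
proof -
  obtain D where D: "0 < D" "\<And>x. x \<in> X \<Longrightarrow> norm (x - e0) \<le> D" by (rule dom_bound) blast
  have lip: "\<beta>-lipschitz_on X (grad F)" using smooth by (simp add: smooth_on_def)
  then have \<beta>: "0 \<le> \<beta>" by (rule lipschitz_on_nonneg)
  define B where "B = norm (grad F e0) + \<beta> * D"
  have B0: "0 \<le> B" using \<beta> D by (simp add: B_def)
  have B: "norm (grad F x) \<le> B" if "x \<in> X" for x
  proof -
    have "norm (grad F x) \<le> norm (grad F e0) + norm (grad F x - grad F e0)"
      by (metis add.commute diff_add_cancel norm_triangle_ineq)
    also have "\<dots> \<le> norm (grad F e0) + \<beta> * norm (x - e0)"
      using lipschitz_onD[OF lip that centre_mem] by (simp add: dist_norm)
    also have "\<dots> \<le> B" unfolding B_def using D(2)[OF that] \<beta> by (intro add_left_mono mult_left_mono)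
    finally show ?thesis .
  qed
  have F_lip: "\<bar>F x - F y\<bar> \<le> B * norm (x - y)" if x: "x \<in> X" and y: "y \<in> X" for x y
  proof -
    have "F a - F b \<le> B * norm (a - b)" if a: "a \<in> X" and b: "b \<in> X" for a b
    proof -
      have "F a - F b \<le> grad F b \<bullet> (a - b)"
        using concave_on_gradient_le[OF F_concave F_GDERIV[OF b] b a] by simp
      also have "\<dots> \<le> norm (grad F b) * norm (a - b)" by (rule norm_cauchy_schwarz)
      also have "\<dots> \<le> B * norm (a - b)" using B[OF b] by (intro mult_right_mono) auto
      finally show ?thesis .
    qed
    from this[OF x y] this[OF y x] show ?thesis by (simp add: norm_minus_commute abs_le_iff)
  qed
  have d: "(B + \<beta> * D + B)-lipschitz_on X rad_denom"
  proof (rule lipschitz_onI)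
    fix x y assume x: "x \<in> X" and y: "y \<in> X"
    have "rad_denom x - rad_denom y
        = (F x - F y) - ((grad F x - grad F y) \<bullet> (x - e0) + grad F y \<bullet> (x - y))"
      by (simp add: rad_denom_def algebra_simps)
    also have "\<bar>\<dots>\<bar> \<le> \<bar>F x - F y\<bar> + (norm (grad F x - grad F y) * norm (x - e0) + norm (grad F y) * norm (x - y))"
      by (intro order_trans[OF abs_triangle_ineq4] add_mono order_refl
          order_trans[OF abs_triangle_ineq] Cauchy_Schwarz_ineq2)
    also have "\<dots> \<le> B * norm (x - y) + ((\<beta> * norm (x - y)) * D + B * norm (x - y))"
      using F_lip[OF x y] lipschitz_onD[OF lip x y] D x B y \<beta>
      by (intro add_mono mult_mono) (auto simp: dist_norm B0)
    finally show "dist (rad_denom x) (rad_denom y) \<le> (B + \<beta> * D + B) * dist x y"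
      by (simp add: dist_norm algebra_simps)
  qed (use B0 \<beta> D in simp)
  have "(\<beta> / F e0 + B * (B + \<beta> * D + B) / (F e0)\<^sup>2)-lipschitz_on X (\<lambda>x. (- grad F x) /\<^sub>R rad_denom x)"
    using rad_denom_ge F_centre_pos B B0 lip d
    by (intro lipschitz_on_scaleR_inverse) (auto simp: lipschitz_on_minus)
  then have 1: "(\<beta> / F e0 + B * (B + \<beta> * D + B) / (F e0)\<^sup>2)-lipschitz_on X rad_grad"
    by (simp only: rad_grad_def[abs_def])
  have "norm (rad_grad x) \<le> B / F e0" if x: "x \<in> X" for x
  proof -
    have "norm (rad_grad x) = norm (grad F x) / rad_denom x"
      using rad_denom_ge[OF x] F_centre_pos by (simp add: rad_grad_def divide_inverse mult.commute)
    also have "\<dots> \<le> B / F e0"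
      using B[OF x] rad_denom_ge[OF x] F_centre_pos B0 by (intro frac_le) auto
    finally show ?thesis .
  qed
  then show thesis using 1 B0 F_centre_pos by (intro that[of _ "B / F e0"]) auto
qed

text \<open>The projection estimate carries the factor \<open>w = rad \<tau> z\<close>. The root
  equation forces \<open>1 \<le> t * (w * B)\<close>, so \<open>w\<close> is bounded below and one
  constant serves all \<open>\<tau> \<le> t\<close>.\<close>

lemma rad_smooth:
  obtains L where "\<And>\<tau>. 0 < \<tau> \<Longrightarrow> \<tau> \<le> t \<Longrightarrow> smooth_on L UNIV (rad \<tau>)"
proof -
  obtain K M where K: "K-lipschitz_on X rad_grad" and M: "0 \<le> M" "\<And>x. x \<in> X \<Longrightarrow> norm (rad_grad x) \<le> M"
    by (rule rad_grad_lipschitz) blast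
  obtain D where D: "0 < D" "\<And>x. x \<in> X \<Longrightarrow> norm (x - e0) \<le> D" by (rule dom_bound) blast
  obtain B where B: "0 < B" "\<And>x. F x \<le> B" by (rule F_bounded) blast
  have K0: "0 \<le> K" using K by (rule lipschitz_on_nonneg)
  define L where "L = K * ((1 + M * D) * (t * B))"
  have "smooth_on L UNIV (rad \<tau>)" if \<tau>: "0 < \<tau>" "\<tau> \<le> t" for \<tau>
  proof (rule smooth_on_subgradient[OF rad_subgradient[OF \<tau>(1)]], rule lipschitz_onI)
    show "0 \<le> L" using K0 M D B \<tau> by (simp add: L_def)
    fix y z
    define v w where "v = rad \<tau> y" and "w = rad \<tau> z"
    have v: "0 < v" and w: "0 < w" using \<tau> by (auto simp: v_def w_def rad_pos)
    have mem: "pt y (rad \<tau> y) \<in> X" for y using \<tau> by (simp add: mem_dom_iff F_pt_rad_pos)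
    have y: "pt y v \<in> X" and z: "pt z w \<in> X" using mem by (auto simp: v_def w_def)
    have rad_lip: "rad \<tau> a - rad \<tau> b \<le> M * norm (a - b)" for a b
    proof -
      have "rad \<tau> a - rad \<tau> b \<le> rad_grad (pt a (rad \<tau> a)) \<bullet> (a - b)"
        using rad_subgradient[OF \<tau>(1), of a b] by (simp add: inner_diff_right)
      also have "\<dots> \<le> norm (rad_grad (pt a (rad \<tau> a))) * norm (a - b)" by (rule norm_cauchy_schwarz)
      also have "\<dots> \<le> M * norm (a - b)" using M(2)[OF mem] by (intro mult_right_mono) auto
      finally show ?thesis .
    qed
    have wv: "\<bar>w - v\<bar> \<le> M * norm (y - z)"
      using rad_lip[of y z] rad_lip[of z y] by (simp add: v_def w_def norm_minus_commute abs_le_iff)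
    have "w * norm (pt y v - pt z w) \<le> norm (y - z) + \<bar>w - v\<bar> * norm ((y - e0) /\<^sub>R v)"
      using radial_projection_dist[OF v w, of y e0 z] by (simp add: pt_def)
    also have "\<dots> \<le> norm (y - z) + (M * norm (y - z)) * D"
      using wv D(2)[OF y] M by (intro add_left_mono mult_mono) (auto simp: pt_def)
    finally have *: "w * norm (pt y v - pt z w) \<le> (1 + M * D) * norm (y - z)"
      by (simp add: algebra_simps)
    have "1 = \<tau> * (w * F (pt z w))" using rad_root[OF \<tau>(1), of z] by (simp add: w_def)
    also have "\<dots> \<le> t * (w * B)" using \<tau> w B by (intro mult_mono) auto
    finally have "norm (pt y v - pt z w) \<le> (t * (w * B)) * norm (pt y v - pt z w)"
      using mult_right_mono[of 1 _ "norm (pt y v - pt z w)"] by simp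
    also have "\<dots> = (t * B) * (w * norm (pt y v - pt z w))" by simp
    also have "\<dots> \<le> (t * B) * ((1 + M * D) * norm (y - z))"
      using * \<tau> B by (intro mult_left_mono) auto
    finally have **: "norm (pt y v - pt z w) \<le> (t * B) * ((1 + M * D) * norm (y - z))" .
    have "dist (rad_grad (pt y v)) (rad_grad (pt z w)) \<le> K * norm (pt y v - pt z w)"
      using lipschitz_onD[OF K y z] by (simp add: dist_norm)
    also have "\<dots> \<le> K * ((t * B) * ((1 + M * D) * norm (y - z)))"
      using ** K0 by (intro mult_left_mono)
    finally show "dist (rad_grad (pt y (rad \<tau> y))) (rad_grad (pt z (rad \<tau> z))) \<le> L * dist y z"
      by (simp add: L_def v_def w_def dist_norm mult_ac)
  qed
  then show thesis using that by blast
qed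

end

section \<open>The max-type problem\<close>

lemma max_fun_le_iff: "max_fun m h y \<le> c \<longleftrightarrow> (\<forall>j\<le>m. h j y \<le> c)"
  unfolding max_fun_def by (subst Max_le_iff) auto

lemma continuous_on_max_fun:
  fixes h :: "nat \<Rightarrow> 'a::topological_space \<Rightarrow> real"
  assumes "\<And>j. j \<le> m \<Longrightarrow> continuous_on X (h j)"
  shows "continuous_on X (max_fun m h)"
  using assms
proof (induction m)
  case 0
  then show ?case by (simp add: max_fun_def[abs_def])
next
  case (Suc m)
  have "max_fun (Suc m) h = (\<lambda>y. max (h (Suc m) y) (max_fun m h y))"
    unfolding max_fun_def atMost_Suc image_insert by (intro ext, subst Max_insert) auto
  then show ?case using Suc by (auto intro!: continuous_on_max)
qed

locale multiradial_problem = radial_objective f e0 \<beta>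
  for f :: "'a::euclidean_space \<Rightarrow> ennreal" and e0 \<beta> +
  fixes S :: "nat \<Rightarrow> 'a set" and e :: "nat \<Rightarrow> 'a" and m :: nat and x_star x_SL x0 :: 'a and b :: real
  assumes m_pos: "1 \<le> m"
    and bodies: "\<And>j. j \<in> {1..m} \<Longrightarrow> centred_body (S j) (e j)"
    and smooth_bodies: "\<And>j. j \<in> {1..m} \<Longrightarrow> smooth_set \<beta> (S j)"
    and x_star: "x_star \<in> (\<Inter>j\<in>{1..m}. S j)" "x_star \<in> eff_dom f"
    and x_star_max: "\<And>x. x \<in> (\<Inter>j\<in>{1..m}. S j) \<Longrightarrow> enn2real (f x) \<le> enn2real (f x_star)"
    and x_SL: "x_SL \<in> eff_dom f"
    and slater: "0 < (1 - enn2real (set_gauge (closure (eff_dom f)) e0 x_star)) * (1 - enn2real (phi_S m S e x_SL))"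
    and x0: "x0 \<in> eff_dom f" "x0 \<in> (\<Inter>j\<in>{1..m}. S j)"
    and inner_radius_pos: "0 < inner_radius e0 (closure (eff_dom f))"
    and b_ge_2: "2 \<le> b"
begin

section \<open>Problem constants and the components of the max-type function\<close>

definition SS :: "'a set" where "SS = (\<Inter>j\<in>{1..m}. S j)"
definition p :: real where "p = F x_star"
definition \<rho> :: real where
  "\<rho> = inner_radius e0 (closure X) / (diameter (closure X) + inner_radius e0 (closure X))"
definition \<gamma> :: real where "\<gamma> = enn2real (set_gauge (closure X) e0 x_star)"
definition \<phi> :: real where "\<phi> = enn2real (phi_S m S e x_SL)"
definition \<eta> :: real where "\<eta> = (1 - \<gamma>) * (1 - \<phi>)"
definition \<tau>0 :: real where "\<tau>0 = 1 / F x0"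
definition \<Psi> :: "real \<Rightarrow> 'a \<Rightarrow> real" where "\<Psi> \<tau> = max_fun m (Phi_component f e0 S e \<tau>)"

lemma p_pos: "0 < p" and F_x0_pos: "0 < F x0"
  using x_star x0 by (auto simp: p_def mem_dom_iff)

lemma F_le_p: "x \<in> SS \<Longrightarrow> F x \<le> p"
  using x_star_max by (simp add: p_def SS_def)

lemma F_x0_le_p: "F x0 \<le> p"
  using F_le_p x0 by (simp add: SS_def)

text \<open>A ball inside the closed domain makes the diameter positive, whence the strict bound
  \<open>\<rho> < 1\<close>; it is what keeps \<open>\<kappa>\<close> positive.\<close>

lemma \<rho>_pos: "0 < \<rho>" and \<rho>_less_1: "\<rho> < 1"
proof -
  obtain r where r: "0 < r" "cball e0 r \<subseteq> closure X"
    using centre by (auto simp: mem_interior_cball)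
  have "diameter (cball e0 r) \<le> diameter (closure X)"
    using r(2) bounded_dom by (rule diameter_subset)
  then have "0 < diameter (closure X)" using r by simp
  then show "0 < \<rho>" "\<rho> < 1"
    using inner_radius_pos by (auto simp: \<rho>_def divide_less_eq add_pos_pos)
qed

lemma \<rho>_p_le: "\<rho> * p \<le> F e0"
  using inner_radius_le[OF x_star(2)] by (simp add: \<rho>_def p_def)

lemma \<gamma>_less_1: "\<gamma> < 1"
  unfolding \<gamma>_def using set_gauge_dom_less_1[OF x_star(2)]
  by (cases "set_gauge (closure X) e0 x_star") (auto simp: ennreal_less_one_iff)

lemma \<eta>_pos: "0 < \<eta>"
  using slater by (simp add: \<eta>_def \<gamma>_def \<phi>_def)

lemma \<phi>_less_1: "\<phi> < 1"
  using \<eta>_pos \<gamma>_less_1 by (simp add: \<eta>_def zero_less_mult_iff)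

lemma \<eta>_le_1: "\<eta> \<le> 1"
proof -
  have "\<eta> \<le> 1 * 1"
    unfolding \<eta>_def using \<phi>_less_1 by (intro mult_mono) (auto simp: \<gamma>_def \<phi>_def)
  then show ?thesis by simp
qed

lemma component_0: "Phi_component f e0 S e \<tau> 0 = rad \<tau>"
  by (rule ext) (simp add: Phi_component_def rad_def)

lemma component_gauge:
  assumes "j \<in> {1..m}"
  shows "Phi_component f e0 S e \<tau> j = (\<lambda>y. (centred_body.body_gauge (S j) (e j) y)\<^sup>2)"
  using assms by (intro ext) (auto simp: Phi_component_def centred_body.body_gauge_def[OF bodies])

lemma component_convex: "0 < \<tau> \<Longrightarrow> j \<le> m \<Longrightarrow> convex_on UNIV (Phi_component f e0 S e \<tau> j)"
  using component_gauge[of j \<tau>] centred_body.gauge2_convex[OF bodies, of j] rad_convex[of \<tau>]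
  by (cases "j = 0") (auto simp: component_0)

lemma valid_smoothness_exists: "\<exists>L. valid_smoothness f e0 m S e {1 / p..\<tau>0} L"
proof -
  obtain L0 where L0: "\<And>\<tau>. 0 < \<tau> \<Longrightarrow> \<tau> \<le> \<tau>0 \<Longrightarrow> smooth_on L0 UNIV (rad \<tau>)" by (rule rad_smooth) blast
  have "\<exists>L. smooth_on L UNIV (\<lambda>y. (centred_body.body_gauge (S j) (e j) y)\<^sup>2)" if "j \<in> {1..m}" for j
    using centred_body.gauge2_smooth[OF bodies[OF that] smooth_bodies[OF that]] by blast
  then obtain M where M: "\<And>j. j \<in> {1..m} \<Longrightarrow> smooth_on (M j) UNIV (\<lambda>y. (centred_body.body_gauge (S j) (e j) y)\<^sup>2)"
    by metis
  \<comment> \<open>The sum dominates every component constant, and the added 1 makes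
    \<open>L\<close> positive. The constants \<open>M j\<close> do not involve
    \<open>\<tau>\<close>, and \<open>L0\<close> is uniform up to \<open>\<tau>0\<close>.\<close>
  define L where "L = 1 + \<bar>L0\<bar> + (\<Sum>j\<in>{1..m}. \<bar>M j\<bar>)"
  have sum0: "0 \<le> (\<Sum>j\<in>{1..m}. \<bar>M j\<bar>)" by (rule sum_nonneg) simp
  have "smooth_on L UNIV (Phi_component f e0 S e \<tau> j)" if \<tau>: "\<tau> \<in> {1 / p..\<tau>0}" and j: "j \<le> m" for \<tau> j
  proof (cases "j = 0")
    case True
    have "0 < \<tau>" using \<tau> p_pos less_le_trans[of 0 "1 / p" \<tau>] by simp
    moreover have "L0 \<le> L" using sum0 unfolding L_def by linarith
    ultimately show ?thesis using L0[of \<tau>] \<tau> True by (simp add: component_0 smooth_on_mono)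
  next
    case False
    then have j': "j \<in> {1..m}" using j by simp
    then have "\<bar>M j\<bar> \<le> (\<Sum>j\<in>{1..m}. \<bar>M j\<bar>)" by (intro member_le_sum) auto
    then have "M j \<le> L" by (simp add: L_def)
    then show ?thesis using M[OF j'] by (simp add: component_gauge[OF j'] smooth_on_mono)
  qed
  moreover have "0 < L" using sum0 unfolding L_def by linarith
  ultimately show ?thesis unfolding valid_smoothness_def by blast
qed

lemma mem_SS_iff: "y \<in> SS \<longleftrightarrow> (\<forall>j\<in>{1..m}. centred_body.body_gauge (S j) (e j) y \<le> 1)"
  using centred_body.mem_iff_gauge_le_1[OF bodies] by (auto simp: SS_def)

lemma \<Psi>_le_iff:
  assumes "0 \<le> c"
  shows "\<Psi> \<tau> y \<le> c \<longleftrightarrow> rad \<tau> y \<le> c \<and> (\<forall>j\<in>{1..m}. (centred_body.body_gauge (S j) (e j) y)\<^sup>2 \<le> c)"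
proof -
  have "{..m} = insert 0 {1..m}" by auto
  then have "(\<forall>j\<le>m. P j) \<longleftrightarrow> P 0 \<and> (\<forall>j\<in>{1..m}. P j)" for P
    by (metis atMost_iff insert_iff)
  then show ?thesis
    unfolding \<Psi>_def max_fun_le_iff by (simp add: component_0 component_gauge)
qed

lemma \<Psi>_le_1_imp_mem: "\<Psi> \<tau> y \<le> 1 \<Longrightarrow> y \<in> SS"
  using centred_body.gauge_nonneg[OF bodies]
  by (auto simp: \<Psi>_le_iff mem_SS_iff power_le_one_iff)

lemma compact_SS: "compact SS"
proof -
  have "compact (S 1)" and "\<And>j. j \<in> {1..m} \<Longrightarrow> closed (S j)"
    using bodies m_pos by (auto simp: centred_body_def intro: compact_imp_closed)
  then have "compact (S 1 \<inter> SS)" unfolding SS_def by (intro compact_Int_closed closed_INT) auto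
  moreover have "S 1 \<inter> SS = SS" using m_pos by (auto simp: SS_def)
  ultimately show ?thesis by simp
qed

lemma \<Psi>_continuous: "0 < \<tau> \<Longrightarrow> continuous_on UNIV (\<Psi> \<tau>)"
  unfolding \<Psi>_def using component_convex
  by (intro continuous_on_max_fun convex_on_continuous) auto

text \<open>\<open>rad \<tau> y \<le> 1 - k\<close> makes the perspective grow by at least
  \<open>k * F e0\<close> up to scale 1, and \<open>\<tau> * F e0 \<ge> \<rho>\<close> because
  \<open>\<tau> * p \<ge> 1\<close>.\<close>

lemma \<Psi>_decrease_imp:
  assumes \<tau>: "1 / p \<le> \<tau>" and k: "0 \<le> k" "\<Psi> \<tau> y \<le> 1 - k"
  shows "y \<in> SS" "1 + k * \<rho> \<le> \<tau> * F y"
proof -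
  show "y \<in> SS" using k by (intro \<Psi>_le_1_imp_mem[of \<tau>]) simp
  have \<tau>0: "0 < \<tau>" using \<tau> p_pos less_le_trans[of 0 "1 / p" \<tau>] by simp
  have rad: "rad \<tau> y \<le> 1 - k"
    using k component_0[of \<tau>] by (auto simp: \<Psi>_def max_fun_le_iff)
  have "\<rho> * 1 \<le> \<rho> * (\<tau> * p)" using \<tau> p_pos \<rho>_pos by (intro mult_left_mono) (auto simp: divide_le_eq)
  also have "\<dots> = \<tau> * (\<rho> * p)" by simp
  also have "\<dots> \<le> \<tau> * F e0" using \<rho>_p_le \<tau>0 by (intro mult_left_mono) auto
  finally have "k * \<rho> \<le> (1 - rad \<tau> y) * (\<tau> * F e0)"
    using rad k \<rho>_pos by (intro mult_mono) auto
  moreover have "1 + (1 - rad \<tau> y) * (\<tau> * F e0) \<le> \<tau> * F y"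
    using rad k by (intro rad_le_imp_F_ge[OF \<tau>0]) auto
  ultimately show "1 + k * \<rho> \<le> \<tau> * F y" by linarith
qed

lemma gauge2_x_SL:
  assumes j: "j \<in> {1..m}"
  shows "(centred_body.body_gauge (S j) (e j) x_SL)\<^sup>2 \<le> \<phi>"
proof -
  have eq: "(set_gauge (S i) (e i) x_SL)\<^sup>2 = ennreal ((centred_body.body_gauge (S i) (e i) x_SL)\<^sup>2)"
    if "i \<in> {1..m}" for i
    using centred_body.set_gauge_eq[OF bodies[OF that]] centred_body.gauge_nonneg[OF bodies[OF that]]
    by (simp add: ennreal_power)
  have fin: "phi_S m S e x_SL < \<infinity>"
    unfolding phi_S_def using m_pos by (subst Max_less_iff) (auto simp: eq)
  have "ennreal ((centred_body.body_gauge (S j) (e j) x_SL)\<^sup>2) \<le> phi_S m S e x_SL"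
    unfolding phi_S_def using j by (intro Max_ge) (auto simp: eq[symmetric])
  also have "\<dots> = ennreal \<phi>" unfolding \<phi>_def using fin by simp
  finally show ?thesis by (simp add: \<phi>_def)
qed

text \<open>The witness is the point \<open>(1 - t) x_star + t x_SL\<close> for which the two convexity bounds,
  on the radial transform and on the squared gauges, coincide.\<close>

lemma \<Psi>_small_point:
  assumes \<tau>: "1 / p \<le> \<tau>"
  obtains y where "\<Psi> \<tau> y \<le> 1 - \<eta> * (1 - 1 / (\<tau> * p)) * \<rho> / (1 + \<rho>)"
proof -
  have \<tau>0: "0 < \<tau>" using \<tau> p_pos less_le_trans[of 0 "1 / p" \<tau>] by simp
  define \<theta> where "\<theta> = 1 / (\<tau> * p)"
  have \<theta>: "0 < \<theta>" "\<theta> \<le> 1" using \<tau>0 p_pos \<tau> by (auto simp: \<theta>_def divide_simps mult.commute)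
  define a where "a = (1 - \<gamma>) * (1 - \<theta>)"
  have a0: "0 \<le> a" using \<gamma>_less_1 \<theta> by (simp add: a_def)
  have a1: "a \<le> 1 - \<theta>" using \<theta> mult_right_mono[of "1 - \<gamma>" 1 "1 - \<theta>"] by (simp add: a_def \<gamma>_def)
  \<comment> \<open>A bound for the radial transform at the Slater point.\<close>
  define M where "M = 1 + \<theta> / \<rho>"
  have \<phi>0: "0 \<le> \<phi>" by (simp add: \<phi>_def)
  have M: "1 < M" using \<theta> \<rho>_pos by (simp add: M_def)
  \<comment> \<open>The solution of
    \<open>(1 - t) * (1 - a) + t * M = 1 - t * (1 - \<phi>)\<close>.\<close>
  define t where "t = a / (M + a - \<phi>)"
  have den: "0 < M + a - \<phi>" using M a0 \<phi>_less_1 by linarith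
  have t: "0 \<le> t" "t \<le> 1" using a0 den M \<phi>_less_1 by (auto simp: t_def)
  define y where "y = (1 - t) *\<^sub>R x_star + t *\<^sub>R x_SL"
  have rad_star: "rad \<tau> x_star \<le> 1 - a"
    using rad_le_set_gauge[OF \<tau>0 x_star(2)] \<tau> p_pos
    by (simp add: a_def \<theta>_def \<gamma>_def p_def divide_le_eq mult.commute)
  have "rad \<tau> x_SL \<le> 1 + 1 / (\<tau> * F e0)" by (rule rad_dom_le[OF \<tau>0 x_SL])
  also have "1 / (\<tau> * F e0) \<le> 1 / (\<tau> * (\<rho> * p))"
    using \<rho>_p_le \<tau>0 \<rho>_pos p_pos F_centre_pos by (intro divide_left_mono mult_left_mono) auto
  also have "\<dots> = \<theta> / \<rho>" by (simp add: \<theta>_def)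
  finally have rad_SL: "rad \<tau> x_SL \<le> M" by (simp add: M_def)
  have "rad \<tau> y \<le> (1 - t) * rad \<tau> x_star + t * rad \<tau> x_SL"
    unfolding y_def using t by (intro convex_onD[OF rad_convex[OF \<tau>0]]) auto
  also have "\<dots> \<le> (1 - t) * (1 - a) + t * M"
    using rad_star rad_SL t by (intro add_mono mult_left_mono) auto
  also have "\<dots> = 1 - t * (1 - \<phi>) + (t * (M + a - \<phi>) - a)" by (simp add: algebra_simps)
  also have "t * (M + a - \<phi>) = a" using den by (simp add: t_def)
  finally have 1: "rad \<tau> y \<le> 1 - t * (1 - \<phi>)" by simp
  have 2: "(centred_body.body_gauge (S j) (e j) y)\<^sup>2 \<le> 1 - t * (1 - \<phi>)" if j: "j \<in> {1..m}" for j
  proof -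
    interpret centred_body "S j" "e j" using j by (rule bodies)
    have "(body_gauge x_star)\<^sup>2 \<le> 1"
      using x_star(1) j mem_SS_iff[of x_star] by (auto simp: SS_def power_le_one)
    moreover have "(body_gauge y)\<^sup>2 \<le> (1 - t) * (body_gauge x_star)\<^sup>2 + t * (body_gauge x_SL)\<^sup>2"
      unfolding y_def using t by (intro convex_onD[OF gauge2_convex]) auto
    moreover have "(1 - t) * (body_gauge x_star)\<^sup>2 + t * (body_gauge x_SL)\<^sup>2 \<le> (1 - t) * 1 + t * \<phi>"
      using calculation(1) gauge2_x_SL[OF j] t by (intro add_mono mult_left_mono) auto
    ultimately have "(body_gauge y)\<^sup>2 \<le> (1 - t) * 1 + t * \<phi>" by linarith
    then show ?thesis by (simp add: algebra_simps)
  qed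
  \<comment> \<open>With \<open>a \<le> 1 - \<theta>\<close> this bounds the denominator
    \<open>M + a - \<phi>\<close> of \<open>t\<close> by \<open>1 + 1 / \<rho>\<close>,
    independently of \<open>\<theta>\<close>.\<close>
  have "\<theta> / \<rho> + 1 - \<theta> \<le> 1 / \<rho>"
  proof -
    have "0 \<le> (1 - \<theta>) * (1 - \<rho>) / \<rho>" using \<theta> \<rho>_pos \<rho>_less_1 by simp
    also have "\<dots> = 1 / \<rho> - (\<theta> / \<rho> + 1 - \<theta>)" using \<rho>_pos by (simp add: field_simps)
    finally show ?thesis by simp
  qed
  then have "M + a - \<phi> \<le> 1 + 1 / \<rho>" using a1 \<phi>0 by (simp add: M_def)
  then have "a / (1 + 1 / \<rho>) \<le> t"
    unfolding t_def using a0 den by (intro divide_left_mono) auto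
  then have "a / (1 + 1 / \<rho>) * (1 - \<phi>) \<le> t * (1 - \<phi>)"
    using \<phi>_less_1 by (intro mult_right_mono) auto
  moreover have "a / (1 + 1 / \<rho>) * (1 - \<phi>) = \<eta> * (1 - \<theta>) * \<rho> / (1 + \<rho>)"
    using \<rho>_pos by (simp add: a_def \<eta>_def field_simps)
  ultimately have 3: "1 - t * (1 - \<phi>) \<le> 1 - \<eta> * (1 - \<theta>) * \<rho> / (1 + \<rho>)" by simp
  have "t * (1 - \<phi>) \<le> 1 * 1" using t \<phi>0 \<phi>_less_1 by (intro mult_mono) auto
  then have "\<Psi> \<tau> y \<le> 1 - t * (1 - \<phi>)"
    using 1 2 by (subst \<Psi>_le_iff) auto
  then show thesis using 3 unfolding \<theta>_def by (intro that) (rule order_trans)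
qed

text \<open>Outside the compact set \<open>SS\<close> the value exceeds 1, while
  \<open>\<Psi>_small_point\<close> provides a value of at most 1; so a minimizer over
  \<open>SS\<close> is a global one.\<close>

lemma \<Psi>_minimizer:
  assumes \<tau>: "1 / p \<le> \<tau>"
  obtains y where "y \<in> SS" "\<And>z. \<Psi> \<tau> y \<le> \<Psi> \<tau> z"
proof -
  have \<tau>0: "0 < \<tau>" using \<tau> p_pos less_le_trans[of 0 "1 / p" \<tau>] by simp
  have "SS \<noteq> {}" using x_star by (auto simp: SS_def)
  then obtain y where y: "y \<in> SS" "\<And>z. z \<in> SS \<Longrightarrow> \<Psi> \<tau> y \<le> \<Psi> \<tau> z"
    using continuous_attains_inf[OF compact_SS _ continuous_on_subset[OF \<Psi>_continuous[OF \<tau>0]]] by blast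
  obtain q where q: "\<Psi> \<tau> q \<le> 1 - \<eta> * (1 - 1 / (\<tau> * p)) * \<rho> / (1 + \<rho>)" by (rule \<Psi>_small_point[OF \<tau>])
  have "0 \<le> \<eta> * (1 - 1 / (\<tau> * p)) * \<rho> / (1 + \<rho>)"
    using \<eta>_pos \<rho>_pos \<tau> \<tau>0 p_pos by (simp add: divide_le_eq mult.commute)
  then have q1: "\<Psi> \<tau> q \<le> 1" using q by linarith
  have "\<Psi> \<tau> y \<le> \<Psi> \<tau> z" for z
    using y(2)[of z] y(2)[OF \<Psi>_le_1_imp_mem[OF q1]] q1 \<Psi>_le_1_imp_mem[of \<tau> z]
    by (cases "\<Psi> \<tau> z \<le> 1") auto
  then show thesis using y that by blast
qed

text \<open>Makes \<open>A * p / \<epsilon>\<close> the argument of the logarithm in the bound on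
  \<open>N\<close>. As long as the gap exceeds \<open>A * \<delta> * p\<close>, the instance of
  accuracy \<open>\<delta>\<close> is sure to restart.\<close>

definition A :: real where "A = b * p / (\<rho>\<^sup>2 * \<eta> * F x0)"

text \<open>The accuracy asked of the gradient method in units of \<open>\<delta>\<close>; it solves
  \<open>2 / (\<rho> * (1 + \<rho>)) - \<kappa> = 1 / \<rho>\<close>.\<close>

definition \<kappa> :: real where "\<kappa> = (1 - \<rho>) / (\<rho> * (1 + \<rho>))"

text \<open>The guaranteed iteration count for accuracy \<open>\<kappa> * \<delta>\<close> from a
  start in \<open>SS\<close>, whose distance to a minimizer in \<open>SS\<close> is at most the
  diameter.\<close>

definition window :: "real \<Rightarrow> real \<Rightarrow> nat" where
  "window L \<delta> = nat \<lceil>2 * sqrt (L * (diameter SS)\<^sup>2 / (\<kappa> * \<delta>))\<rceil>"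

lemma \<kappa>_pos: "0 < \<kappa>"
  using \<rho>_pos \<rho>_less_1 by (simp add: \<kappa>_def)

lemma A_pos: "0 < A"
  using b_ge_2 p_pos \<rho>_pos \<eta>_pos F_x0_pos by (simp add: A_def)

text \<open>The factor 2 comes from \<open>b \<ge> 2\<close> and \<open>F x0 \<le> p\<close>; it
  leaves room for the inaccuracy \<open>\<kappa> * \<delta>\<close> of an iterate.\<close>

lemma A_ge: "2 \<le> A * (\<rho>\<^sup>2 * \<eta>)" and A_ge_1: "1 \<le> A"
proof -
  have "b * 1 \<le> b * (p / F x0)"
    using b_ge_2 F_x0_le_p F_x0_pos by (intro mult_left_mono) auto
  also have "\<dots> = A * (\<rho>\<^sup>2 * \<eta>)" using \<rho>_pos \<eta>_pos by (simp add: A_def)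
  finally show *: "2 \<le> A * (\<rho>\<^sup>2 * \<eta>)" using b_ge_2 by simp
  have "\<rho>\<^sup>2 * \<eta> \<le> 1 * 1"
    using \<rho>_pos \<rho>_less_1 \<eta>_pos \<eta>_le_1 by (intro mult_mono) (auto simp: power_le_one)
  then have "A * (\<rho>\<^sup>2 * \<eta>) \<le> A * 1" using A_pos by (intro mult_left_mono) auto
  then show "1 \<le> A" using * by simp
qed

text \<open>The gap puts the minimum of \<open>\<Psi> \<tau>\<close> at or below
  \<open>1 - 2 * \<delta> / (\<rho> * (1 + \<rho>))\<close>. An iterate within
  \<open>\<kappa> * \<delta>\<close> of it has value at most \<open>1 - \<delta> / \<rho>\<close>,
  where \<open>\<Psi>_decrease_imp\<close> applies.\<close>

lemma genGrad_reaches_restart: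
  fixes G :: "('a, 's) gradient_method"
  assumes G: "accelerated_genGrad G" and L: "valid_smoothness f e0 m S e {1 / p..\<tau>0} L"
    and \<tau>: "1 / p \<le> \<tau>" "\<tau> \<le> \<tau>0" and \<delta>: "0 < \<delta>" and gap: "A * \<delta> * p < p - 1 / \<tau>"
    and x: "x \<in> SS"
  obtains k y where "k \<le> window L \<delta>"
    "y = gm_iterate G ((genGrad_step G L m (Phi_component f e0 S e \<tau>) ^^ k) (genGrad_init G L x))"
    "y \<in> SS" "1 + \<delta> \<le> \<tau> * F y"
proof -
  let ?h = "Phi_component f e0 S e \<tau>"
  have \<tau>0: "0 < \<tau>" using \<tau> p_pos less_le_trans[of 0 "1 / p" \<tau>] by simp
  have L0: "0 < L" and comp: "\<forall>j\<le>m. convex_on UNIV (?h j) \<and> smooth_on L UNIV (?h j)"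
    using L \<tau> component_convex[OF \<tau>0] by (auto simp: valid_smoothness_def)
  obtain y where y: "y \<in> SS" "\<And>z. \<Psi> \<tau> y \<le> \<Psi> \<tau> z" using \<tau>(1) by (rule \<Psi>_minimizer) blast
  obtain q where q: "\<Psi> \<tau> q \<le> 1 - \<eta> * (1 - 1 / (\<tau> * p)) * \<rho> / (1 + \<rho>)" by (rule \<Psi>_small_point[OF \<tau>(1)])
  have D: "norm (x - y) \<le> diameter SS"
    using diameter_bounded_bound[OF compact_imp_bounded[OF compact_SS] x y(1)] by (simp add: dist_norm)
  have \<epsilon>: "0 < \<kappa> * \<delta>" using \<kappa>_pos \<delta> by simp
  have "\<forall>y'. max_fun m ?h y \<le> max_fun m ?h y'" using y(2) by (simp add: \<Psi>_def)
  then obtain k where k: "int k \<le> \<lceil>2 * sqrt (L * (diameter SS)\<^sup>2 / (\<kappa> * \<delta>))\<rceil>"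
    "max_fun m ?h (gm_iterate G ((genGrad_step G L m ?h ^^ k) (genGrad_init G L x))) - max_fun m ?h y \<le> \<kappa> * \<delta>"
    using G L0 comp D \<epsilon> unfolding accelerated_genGrad_def by blast
  define z where "z = gm_iterate G ((genGrad_step G L m ?h ^^ k) (genGrad_init G L x))"
  have "A * \<delta> * p / p < (p - 1 / \<tau>) / p" using gap p_pos by (rule divide_strict_right_mono)
  then have "A * \<delta> < 1 - 1 / (\<tau> * p)" using p_pos by (simp add: diff_divide_distrib)
  then have "A * \<delta> * (\<eta> * \<rho> / (1 + \<rho>)) \<le> (1 - 1 / (\<tau> * p)) * (\<eta> * \<rho> / (1 + \<rho>))"
    using \<eta>_pos \<rho>_pos by (intro mult_right_mono) auto
  moreover have "2 * (\<delta> / (\<rho> * (1 + \<rho>))) \<le> (A * (\<rho>\<^sup>2 * \<eta>)) * (\<delta> / (\<rho> * (1 + \<rho>)))"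
    using A_ge \<delta> \<rho>_pos by (intro mult_right_mono) auto
  moreover have "(A * (\<rho>\<^sup>2 * \<eta>)) * (\<delta> / (\<rho> * (1 + \<rho>))) = A * \<delta> * (\<eta> * \<rho> / (1 + \<rho>))"
    using \<rho>_pos by (simp add: power2_eq_square)
  moreover have "2 * (\<delta> / (\<rho> * (1 + \<rho>))) - \<kappa> * \<delta> = \<delta> / \<rho>"
  proof -
    have "2 * (\<delta> / (\<rho> * (1 + \<rho>))) - \<kappa> * \<delta> = \<delta> * (1 + \<rho>) / (\<rho> * (1 + \<rho>))"
      by (simp add: \<kappa>_def diff_divide_distrib algebra_simps add_divide_distrib flip: divide_divide_eq_left)
    then show ?thesis using \<rho>_pos by simp
  qed
  moreover have "\<Psi> \<tau> z \<le> \<Psi> \<tau> q + \<kappa> * \<delta>" using k(2) y(2)[of q] by (simp add: \<Psi>_def z_def)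
  ultimately have "\<Psi> \<tau> z \<le> 1 - \<delta> / \<rho>" using q by (simp add: mult_ac)
  then have "z \<in> SS" "1 + \<delta> / \<rho> * \<rho> \<le> \<tau> * F z"
    using \<delta> \<rho>_pos \<Psi>_decrease_imp[OF \<tau>(1), of "\<delta> / \<rho>" z] by auto
  moreover have "k \<le> window L \<delta>" using k(1) by (simp add: window_def le_nat_iff)
  ultimately show thesis using \<rho>_pos by (intro that[of k z]) (auto simp: z_def)
qed

end

section \<open>Runs of the Parallel MultiRadial Method\<close>

locale multiradial_run = multiradial_problem f e0 \<beta> S e m x_star x_SL x0 b
  for f :: "'a::euclidean_space \<Rightarrow> ennreal" and e0 \<beta> S e m x_star x_SL x0 b +
  fixes G :: "('a, 's) gradient_method" and L :: real and N :: nat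
    and \<tau> :: "nat \<Rightarrow> nat \<Rightarrow> real" and s :: "nat \<Rightarrow> nat \<Rightarrow> 's" and ybest :: "nat \<Rightarrow> 'a"
  assumes G: "accelerated_genGrad G"
    and L: "valid_smoothness f e0 m S e {1 / p..\<tau>0} L"
    and N: "0 < N"
    and run: "parallel_multiradial_run (\<lambda>\<tau>' \<delta> x. genGrad_init G L x)
        (\<lambda>\<tau>'. genGrad_step G L m (Phi_component f e0 S e \<tau>')) (gm_iterate G) f SS x0 b N \<tau> s ybest"
begin

section \<open>Vocabulary and invariants of a run\<close>

definition step :: "real \<Rightarrow> 's \<Rightarrow> 's" where
  "step \<tau>' = genGrad_step G L m (Phi_component f e0 S e \<tau>')"

definition produced :: "nat \<Rightarrow> 'a set" where
  "produced i = produced_iterates step (gm_iterate G) N \<tau> s i"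

text \<open>The index is shifted because a run determines \<open>ybest\<close> only from index 1
  on.\<close>

definition best :: "nat \<Rightarrow> real" where
  "best i = F (ybest (Suc i))"

definition \<delta> :: "nat \<Rightarrow> real" where
  "\<delta> l = (1 / b) ^ l"

definition restart :: "nat \<Rightarrow> nat \<Rightarrow> bool" where
  "restart l i \<longleftrightarrow> 1 / best i \<le> 1 / (1 + \<delta> l) * \<tau> l i"

lemma \<delta>_pos: "0 < \<delta> l"
  using b_ge_2 by (simp add: \<delta>_def)

lemma \<delta>_Suc: "b * \<delta> (Suc l) = \<delta> l"
  using b_ge_2 by (simp add: \<delta>_def)

lemma
  shows run_init: "l \<in> {1..N} \<Longrightarrow> \<tau> l 0 = \<tau>0" "l \<in> {1..N} \<Longrightarrow> s l 0 = genGrad_init G L x0"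
    and run_best: "is_arg_max f (\<lambda>y. y \<in> produced i \<inter> SS) (ybest (Suc i))"
    and run_restart: "l \<in> {1..N} \<Longrightarrow> restart l i \<Longrightarrow> \<tau> l (Suc i) = 1 / best i"
      "l \<in> {1..N} \<Longrightarrow> restart l i \<Longrightarrow> s l (Suc i) = genGrad_init G L (ybest (Suc i))"
    and run_step: "l \<in> {1..N} \<Longrightarrow> \<not> restart l i \<Longrightarrow> \<tau> l (Suc i) = \<tau> l i"
      "l \<in> {1..N} \<Longrightarrow> \<not> restart l i \<Longrightarrow> s l (Suc i) = step (\<tau> l i) (s l i)"
  using run unfolding parallel_multiradial_run_def restart_def best_def \<delta>_def produced_def step_def \<tau>0_def
  by (auto simp: Let_def)

lemma ybest_mem: "ybest (Suc i) \<in> SS"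
  using run_best[of i] by (auto simp: is_arg_max_def)

lemma produced_le_best:
  assumes "y \<in> produced i" "y \<in> SS"
  shows "F y \<le> best i"
proof -
  have "f y \<le> f (ybest (Suc i))"
    using run_best[of i] assms by (auto simp: is_arg_max_def not_less)
  then show ?thesis unfolding best_def using f_finite by (intro enn2real_mono) auto
qed

lemma produced_mono: "i \<le> j \<Longrightarrow> produced i \<subseteq> produced j"
  unfolding produced_def produced_iterates_def by fastforce

lemma iterate_produced: "l \<in> {1..N} \<Longrightarrow> gm_iterate G (s l i) \<in> produced i"
  unfolding produced_def produced_iterates_def by blast

text \<open>Candidates of earlier rounds remain candidates.\<close>

lemma best_mono: "i \<le> j \<Longrightarrow> best i \<le> best j"
  using run_best[of i] produced_mono[of i j] ybest_mem[of i]
  unfolding best_def[of i] by (intro produced_le_best) (auto simp: is_arg_max_def)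

lemma iterate_init: "gm_iterate G (genGrad_init G L x) = x"
  using G L by (auto simp: accelerated_genGrad_def valid_smoothness_def)

lemma best_ge: "F x0 \<le> best i"
proof -
  have "x0 \<in> produced 0"
    using iterate_produced[of 1 0] run_init(2)[of 1] N by (simp add: iterate_init)
  then have "F x0 \<le> best 0" using x0 by (intro produced_le_best) (auto simp: SS_def)
  also have "\<dots> \<le> best i" by (rule best_mono) simp
  finally show ?thesis .
qed

lemma best_pos: "0 < best i"
  using best_ge[of i] F_x0_pos by simp

lemma best_le: "best i \<le> p"
  unfolding best_def by (rule F_le_p) (rule ybest_mem)

text \<open>\<open>1 / \<tau> l i\<close> is always the value of \<open>F\<close> at
  \<open>x0\<close> or at an earlier best iterate, hence never above \<open>best i\<close>.\<close>

lemma \<tau>_bounds: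
  assumes l: "l \<in> {1..N}"
  shows "0 < \<tau> l i \<and> \<tau> l i \<le> \<tau>0 \<and> 1 / \<tau> l i \<le> best i"
proof (induction i)
  case 0
  then show ?case using run_init(1)[OF l] F_x0_pos best_ge[of 0] by (simp add: \<tau>0_def)
next
  case (Suc i)
  show ?case
  proof (cases "restart l i")
    case True
    have "1 / best i \<le> \<tau>0" unfolding \<tau>0_def using best_ge[of i] best_pos[of i] F_x0_pos by (intro divide_left_mono mult_pos_pos) auto
    then show ?thesis using run_restart(1)[OF l True] best_pos[of i] best_mono[of i "Suc i"] by simp
  next
    case False
    then show ?thesis using run_step(1)[OF l] Suc best_mono[of i "Suc i"] by auto
  qed
qed

lemma \<tau>_ge:
  assumes l: "l \<in> {1..N}"
  shows "1 / p \<le> \<tau> l i"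
proof -
  have "1 / \<tau> l i \<le> p" "0 < \<tau> l i" using \<tau>_bounds[OF l, of i] best_le[of i] by auto
  then show ?thesis using p_pos by (simp add: divide_simps mult.commute)
qed

lemma restart_gain:
  assumes l: "l \<in> {1..N}" and r: "restart l i"
  shows "(1 + \<delta> l) * (1 / \<tau> l i) \<le> best i"
proof -
  have "1 \<le> (\<tau> l i / (1 + \<delta> l)) * best i"
    using r best_pos[of i] by (simp add: restart_def pos_divide_le_eq)
  then show ?thesis using \<tau>_bounds[OF l, of i] \<delta>_pos[of l] by (simp add: field_simps)
qed

lemma level_mono_Suc:
  assumes l: "l \<in> {1..N}"
  shows "1 / \<tau> l i \<le> 1 / \<tau> l (Suc i)"
  using \<tau>_bounds[OF l, of i] run_restart(1)[OF l, of i] run_step(1)[OF l, of i]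
  by (cases "restart l i") auto

lemma level_mono: "l \<in> {1..N} \<Longrightarrow> i \<le> j \<Longrightarrow> 1 / \<tau> l i \<le> 1 / \<tau> l j"
  using lift_Suc_mono_le[of "\<lambda>i. 1 / \<tau> l i"] level_mono_Suc by blast

text \<open>Keeping the earlier iterates of the current run in the candidate set matters because the guarantee
  of the accelerated method holds for some iterate, not for the last one.\<close>

definition running :: "nat \<Rightarrow> nat \<Rightarrow> nat \<Rightarrow> bool" where
  "running l n i \<longleftrightarrow> (\<exists>x\<in>SS. \<exists>k\<ge>n. s l i = (step (\<tau> l i) ^^ k) (genGrad_init G L x) \<and>
     (\<forall>k'\<le>k. gm_iterate G ((step (\<tau> l i) ^^ k') (genGrad_init G L x)) \<in> produced i))"

lemma running_step:
  assumes l: "l \<in> {1..N}" and r: "running l n i" and no: "\<not> restart l i"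
  shows "running l (Suc n) (Suc i)"
proof -
  obtain x k where x: "x \<in> SS" and k: "n \<le> k" "s l i = (step (\<tau> l i) ^^ k) (genGrad_init G L x)"
    "\<And>k'. k' \<le> k \<Longrightarrow> gm_iterate G ((step (\<tau> l i) ^^ k') (genGrad_init G L x)) \<in> produced i"
    using r unfolding running_def by blast
  note \<tau>_Suc = run_step(1)[OF l no]
  have s_Suc: "s l (Suc i) = (step (\<tau> l (Suc i)) ^^ Suc k) (genGrad_init G L x)"
    using run_step(2)[OF l no] \<tau>_Suc k(2) by simp
  have "gm_iterate G ((step (\<tau> l (Suc i)) ^^ k') (genGrad_init G L x)) \<in> produced (Suc i)"
    if "k' \<le> Suc k" for k'
  proof (cases "k' = Suc k")
    case True
    then show ?thesis using iterate_produced[OF l, of "Suc i"] s_Suc by simp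
  next
    case False
    then show ?thesis using that k(3)[of k'] produced_mono[of i "Suc i"] \<tau>_Suc by auto
  qed
  then show ?thesis unfolding running_def using x k(1) s_Suc
    by (intro bexI[of _ x] exI[of _ "Suc k"]) auto
qed

text \<open>A restart produces a fresh run, \<open>k = 0\<close>, from the feasible best iterate; in
  any other round the current run is extended.\<close>

lemma running_0:
  assumes l: "l \<in> {1..N}"
  shows "running l 0 i"
proof (induction i)
  case 0
  have "x0 \<in> SS" using x0 by (simp add: SS_def)
  then show ?case unfolding running_def
    using run_init(2)[OF l] iterate_produced[OF l, of 0] by (intro bexI[of _ x0] exI[of _ 0]) auto
next
  case (Suc i)
  show ?case
  proof (cases "restart l i")
    case True
    then show ?thesis unfolding running_def
      using run_restart(2)[OF l True] iterate_produced[OF l, of "Suc i"] ybest_mem[of i]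
      by (intro bexI[of _ "ybest (Suc i)"] exI[of _ 0]) auto
  next
    case False
    then have "running l (Suc 0) (Suc i)" using running_step l Suc by blast
    then show ?thesis unfolding running_def using Suc_leD by blast
  qed
qed

lemma running_no_restart:
  assumes l: "l \<in> {1..N}" and no: "\<And>j. i \<le> j \<Longrightarrow> j < i + n \<Longrightarrow> \<not> restart l j"
  shows "running l n (i + n) \<and> \<tau> l (i + n) = \<tau> l i"
  using no
proof (induction n)
  case 0
  then show ?case using running_0[OF l] by simp
next
  case (Suc n)
  then have "running l n (i + n)" "\<tau> l (i + n) = \<tau> l i" "\<not> restart l (i + n)" by auto
  then show ?case using running_step[OF l] run_step(1)[OF l] by simp
qed

text \<open>Without a restart the current run would contain a full window of iterates at a fixed
  \<open>\<tau>\<close>. One of these meets the restart threshold and is still a candidate in round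
  \<open>i + ?W\<close>, so a restart would happen there.\<close>

lemma restart_in_window:
  assumes l: "l \<in> {1..N}" and gap: "A * \<delta> l * p < p - 1 / \<tau> l i"
  shows "\<exists>j\<ge>i. j \<le> i + window L (\<delta> l) \<and> restart l j"
proof (rule ccontr)
  assume no: "\<not> ?thesis"
  let ?W = "window L (\<delta> l)"
  have no': "\<not> restart l j" if "i \<le> j" "j \<le> i + ?W" for j using that no by blast
  then have "running l ?W (i + ?W)" and \<tau>_eq: "\<tau> l (i + ?W) = \<tau> l i"
    using running_no_restart[OF l, of i ?W] by auto
  then obtain x k where x: "x \<in> SS" and k: "?W \<le> k"
    "\<And>k'. k' \<le> k \<Longrightarrow> gm_iterate G ((step (\<tau> l i) ^^ k') (genGrad_init G L x)) \<in> produced (i + ?W)"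
    unfolding running_def by auto
  obtain k' y where y: "k' \<le> ?W" "y = gm_iterate G ((step (\<tau> l i) ^^ k') (genGrad_init G L x))"
    "y \<in> SS" "1 + \<delta> l \<le> \<tau> l i * F y"
    using genGrad_reaches_restart[OF G L \<tau>_ge[OF l] _ \<delta>_pos gap x] \<tau>_bounds[OF l, of i]
    unfolding step_def by blast
  have "F y \<le> best (i + ?W)" using y k by (intro produced_le_best) auto
  then have "\<tau> l i * F y \<le> \<tau> l i * best (i + ?W)"
    using \<tau>_bounds[OF l, of i] by (intro mult_left_mono) auto
  then have "1 + \<delta> l \<le> \<tau> l i * best (i + ?W)" using y by linarith
  then have "restart l (i + ?W)"
    using best_pos[of "i + ?W"] \<delta>_pos[of l] \<tau>_eq by (simp add: restart_def divide_simps mult.commute)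
  then show False using no' by simp
qed

text \<open>The first restart is only credited with lifting \<open>1 / \<tau>\<close> to
  \<open>best i\<close>, since other instances may be ahead. Each further one multiplies it by at
  least \<open>1 + \<delta> l\<close>, a gain of at least \<open>\<delta> l * F x0\<close>. A period
  is one longer than a window because a restart in round \<open>j\<close> shows in
  \<open>\<tau> l (Suc j)\<close>.\<close>

lemma level_progress:
  assumes l: "l \<in> {1..N}"
    and gap: "\<And>j. i \<le> j \<Longrightarrow> j \<le> i + Suc n * Suc (window L (\<delta> l)) \<Longrightarrow> A * \<delta> l * p < p - best j"
  shows "best i + n * (\<delta> l * F x0) \<le> 1 / \<tau> l (i + Suc n * Suc (window L (\<delta> l)))"
  using gap
proof (induction n)
  case 0
  have "A * \<delta> l * p < p - 1 / \<tau> l i" using 0[of i] \<tau>_bounds[OF l, of i] by simp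
  then obtain j where j: "i \<le> j" "j \<le> i + window L (\<delta> l)" "restart l j" using restart_in_window[OF l] by blast
  have "best i \<le> best j" using j by (intro best_mono)
  also have "\<dots> = 1 / \<tau> l (Suc j)" using run_restart(1)[OF l j(3)] by simp
  also have "\<dots> \<le> 1 / \<tau> l (i + Suc (window L (\<delta> l)))" using j by (intro level_mono[OF l]) auto
  finally show ?case by simp
next
  case (Suc n)
  let ?i = "i + Suc n * Suc (window L (\<delta> l))"
  have IH: "best i + n * (\<delta> l * F x0) \<le> 1 / \<tau> l ?i" using Suc.prems by (intro Suc.IH) auto
  have "A * \<delta> l * p < p - best ?i" by (intro Suc.prems) auto
  then have "A * \<delta> l * p < p - 1 / \<tau> l ?i" using \<tau>_bounds[OF l, of ?i] by simp
  then obtain j where j: "?i \<le> j" "j \<le> ?i + window L (\<delta> l)" "restart l j" using restart_in_window[OF l] by blast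
  have lev: "1 / \<tau> l ?i \<le> 1 / \<tau> l j" using j by (intro level_mono[OF l])
  have "F x0 = 1 / \<tau> l 0" using run_init(1)[OF l] by (simp add: \<tau>0_def)
  also have "\<dots> \<le> 1 / \<tau> l j" by (intro level_mono[OF l]) simp
  finally have "\<delta> l * F x0 \<le> \<delta> l * (1 / \<tau> l j)" using \<delta>_pos[of l] by (intro mult_left_mono) auto
  then have "1 / \<tau> l ?i + \<delta> l * F x0 \<le> (1 + \<delta> l) * (1 / \<tau> l j)"
    using lev by (simp only: distrib_right mult_1)
  also have "\<dots> \<le> best j" by (rule restart_gain[OF l j(3)])
  also have "\<dots> = 1 / \<tau> l (Suc j)" using run_restart(1)[OF l j(3)] by simp
  also have "\<dots> \<le> 1 / \<tau> l (?i + Suc (window L (\<delta> l)))" using j by (intro level_mono[OF l]) auto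
  also have "?i + Suc (window L (\<delta> l)) = i + Suc (Suc n) * Suc (window L (\<delta> l))" by simp
  finally show ?case using IH by (simp add: distrib_right)
qed

text \<open>Enough gains of \<open>\<delta> (Suc l) * F x0\<close> to exhaust the gap
  \<open>A * \<delta> l * p\<close>; the number is the same for all \<open>l\<close> because
  consecutive accuracies differ by the factor \<open>b\<close>.\<close>

definition restarts :: nat where
  "restarts = nat \<lceil>A * b * p / F x0\<rceil>"

text \<open>If the finer gap persisted, instance \<open>Suc l\<close> would collect
  \<open>restarts\<close> gains and close the whole gap of level \<open>l\<close>, although a
  positive gap remains.\<close>

lemma stage:
  assumes l: "Suc l \<in> {1..N}" and gap: "p - best i \<le> A * \<delta> l * p"
  shows "\<exists>j \<le> i + Suc restarts * Suc (window L (\<delta> (Suc l))). p - best j \<le> A * \<delta> (Suc l) * p"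
proof (rule ccontr)
  assume no: "\<not> ?thesis"
  let ?j = "i + Suc restarts * Suc (window L (\<delta> (Suc l)))"
  have no': "A * \<delta> (Suc l) * p < p - best j" if "j \<le> ?j" for j using that no not_less by blast
  have "A * b * p / F x0 \<le> real restarts" unfolding restarts_def by linarith
  then have "A * b * p \<le> restarts * F x0" using F_x0_pos by (simp add: divide_le_eq)
  then have "A * b * p * \<delta> (Suc l) \<le> restarts * F x0 * \<delta> (Suc l)"
    using \<delta>_pos[of "Suc l"] by (intro mult_right_mono) auto
  moreover have "A * b * p * \<delta> (Suc l) = A * \<delta> l * p" by (simp only: \<delta>_Suc[of l, symmetric] mult_ac)
  moreover have "best i + restarts * (\<delta> (Suc l) * F x0) \<le> 1 / \<tau> (Suc l) ?j"
    using no' by (intro level_progress[OF l])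
  moreover have "1 / \<tau> (Suc l) ?j \<le> best ?j" using \<tau>_bounds[OF l] by simp
  moreover have "A * \<delta> (Suc l) * p < p - best ?j" by (rule no') simp
  moreover have "0 < A * \<delta> (Suc l) * p" using A_pos \<delta>_pos p_pos by simp
  moreover have "restarts * F x0 * \<delta> (Suc l) = restarts * (\<delta> (Suc l) * F x0)" by simp
  ultimately show False using gap by linarith
qed

lemma reach_level:
  assumes "l \<le> N"
  shows "\<exists>i. i \<le> (\<Sum>l'=1..l. Suc restarts * Suc (window L (\<delta> l'))) \<and> p - best i \<le> A * \<delta> l * p"
  using assms
proof (induction l)
  case 0
  \<comment> \<open>Level 0 costs nothing: the gap never exceeds \<open>p\<close>, and
    \<open>A \<ge> 1\<close>.\<close>
  have "1 * p \<le> A * p" using A_ge_1 p_pos by (intro mult_right_mono) auto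
  then show ?case using best_pos[of 0] by (intro exI[of _ 0]) (auto simp: \<delta>_def)
next
  case (Suc l)
  then obtain i where i: "i \<le> (\<Sum>l'=1..l. Suc restarts * Suc (window L (\<delta> l')))" "p - best i \<le> A * \<delta> l * p" by auto
  have "Suc l \<in> {1..N}" using Suc.prems by simp
  then obtain j where "j \<le> i + Suc restarts * Suc (window L (\<delta> (Suc l)))" "p - best j \<le> A * \<delta> (Suc l) * p"
    using stage i(2) by blast
  then show ?case using i(1) by (intro exI[of _ j]) auto
qed

end

section \<open>Summation of the costs over the levels\<close>

lemma geometric_sum_le:
  fixes r :: real
  assumes "1 < r"
  shows "(\<Sum>l=1..n. r ^ l) \<le> r ^ n * (r / (r - 1))"
proof (induction n)
  case 0
  then show ?case using assms by simp
next
  case (Suc n)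
  have "(\<Sum>l=1..Suc n. r ^ l) \<le> r ^ n * (r / (r - 1)) + r ^ Suc n" using Suc by simp
  also have "\<dots> = r ^ Suc n * (r / (r - 1))" using assms by (simp add: field_simps)
  finally show ?case .
qed

context multiradial_problem
begin

text \<open>The unit lost by rounding up and the extra round of a period are absorbed by the
  constant 2, since \<open>sqrt b ^ l \<ge> 1\<close>.\<close>

lemma window_le:
  assumes L: "0 < L"
  shows "1 + real (window L ((1 / b) ^ l)) \<le> (2 + 2 * sqrt (L * (diameter SS)\<^sup>2 / \<kappa>)) * sqrt b ^ l"
proof -
  have nn: "0 \<le> 2 * sqrt (L * (diameter SS)\<^sup>2 / (\<kappa> * (1 / b) ^ l))"
    using L \<kappa>_pos b_ge_2 by simp
  have "real (window L ((1 / b) ^ l)) \<le> 1 + 2 * sqrt (L * (diameter SS)\<^sup>2 / (\<kappa> * (1 / b) ^ l))"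
    unfolding window_def using nn by linarith
  also have "L * (diameter SS)\<^sup>2 / (\<kappa> * (1 / b) ^ l) = L * (diameter SS)\<^sup>2 / \<kappa> * b ^ l"
    by (simp add: power_divide)
  also have "sqrt \<dots> = sqrt (L * (diameter SS)\<^sup>2 / \<kappa>) * sqrt b ^ l"
    by (simp only: real_sqrt_mult real_sqrt_power)
  finally have "real (window L ((1 / b) ^ l)) \<le> 1 + 2 * (sqrt (L * (diameter SS)\<^sup>2 / \<kappa>) * sqrt b ^ l)" .
  moreover have "1 \<le> sqrt b ^ l" using b_ge_2 by (intro one_le_power) simp
  ultimately show ?thesis by (simp add: algebra_simps)
qed

text \<open>Periods per level, times the constant of \<open>window_le\<close>, times the factor of
  the geometric sum with ratio \<open>sqrt b\<close>. Neither \<open>\<epsilon>\<close> nor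
  \<open>N\<close> occurs.\<close>

definition rate :: "real \<Rightarrow> real" where
  "rate L = real (Suc (nat \<lceil>A * b * p / F x0\<rceil>)) * (2 + 2 * sqrt (L * (diameter SS)\<^sup>2 / \<kappa>)) * (sqrt b / (sqrt b - 1))"

text \<open>The leading 1 is the shift from \<open>best i\<close> to \<open>ybest (Suc i)\<close>;
  the inner 1 covers targets for which level 0 suffices.\<close>

definition iterations :: "real \<Rightarrow> real \<Rightarrow> real" where
  "iterations L \<epsilon> = 1 + rate L * (1 + sqrt (b * A * p) * (1 / sqrt \<epsilon>))"

text \<open>Constants are dominated because \<open>1 / sqrt \<epsilon> \<ge> 1\<close> for
  \<open>\<epsilon> < 1\<close>.\<close>

lemma iterations_bigo: "iterations L \<in> O[at_right 0](\<lambda>\<epsilon>. 1 / sqrt \<epsilon>)"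
proof -
  have "\<forall>\<^sub>F \<epsilon> in at_right (0::real). \<epsilon> \<in> {0<..<1}" by (rule eventually_at_right_real) simp
  then have "\<forall>\<^sub>F \<epsilon> in at_right (0::real). norm c \<le> norm c * norm (1 / sqrt \<epsilon>)" for c :: real
    by (rule eventually_mono) (auto simp: le_divide_eq mult_left_le)
  then have c: "(\<lambda>\<epsilon>. c) \<in> O[at_right 0](\<lambda>\<epsilon>. 1 / sqrt \<epsilon>)" for c :: real by (rule bigoI)
  have "(\<lambda>\<epsilon>. (1 + rate L) + (rate L * sqrt (b * A * p)) * (1 / sqrt \<epsilon>)) \<in> O[at_right 0](\<lambda>\<epsilon>. 1 / sqrt \<epsilon>)"
    by (intro sum_in_bigo c bigoI[of _ "\<bar>rate L * sqrt (b * A * p)\<bar>"] always_eventually) (simp add: abs_mult)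
  then show ?thesis by (simp add: iterations_def[abs_def] algebra_simps)
qed

end

context multiradial_run
begin

lemma \<epsilon>_minimizer_found:
  assumes \<epsilon>: "0 < \<epsilon>" and N': "A * p / \<epsilon> \<le> b ^ N"
  shows "\<exists>i\<ge>1. real i \<le> iterations L \<epsilon> \<and> ybest i \<in> SS \<and> p - F (ybest i) \<le> \<epsilon>"
proof -
  \<comment> \<open>The coarsest sufficient level. Its minimality bounds \<open>b ^ l\<close> in
    terms of \<open>\<epsilon>\<close> alone, and \<open>N\<close> enters only through
    \<open>l \<le> N\<close>.\<close>
  define l where "l = (LEAST l. A * p / \<epsilon> \<le> b ^ l)"
  have l: "A * p / \<epsilon> \<le> b ^ l" "l \<le> N"
    unfolding l_def using N' by (auto intro: LeastI Least_le)
  have bl: "b ^ l \<le> 1 + b * (A * p / \<epsilon>)"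
  proof (cases l)
    case 0
    then show ?thesis using b_ge_2 A_pos p_pos \<epsilon> by simp
  next
    case (Suc k)
    then have "\<not> A * p / \<epsilon> \<le> b ^ k" unfolding l_def by (intro not_less_Least) simp
    then have "b * b ^ k \<le> b * (A * p / \<epsilon>)" using b_ge_2 by (intro mult_left_mono) auto
    then show ?thesis using Suc by simp
  qed
  obtain i where i: "i \<le> (\<Sum>l'=1..l. Suc restarts * Suc (window L (\<delta> l')))" "p - best i \<le> A * \<delta> l * p"
    using reach_level[OF l(2)] by blast
  have L0: "0 < L" using L by (simp add: valid_smoothness_def)
  define r where "r = sqrt b"
  have r: "1 < r" using b_ge_2 by (simp add: r_def)
  define C where "C = 2 + 2 * sqrt (L * (diameter SS)\<^sup>2 / \<kappa>)"
  have C: "0 \<le> C" using L0 \<kappa>_pos by (simp add: C_def)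
  have rate: "rate L = real (Suc restarts) * C * (r / (r - 1))"
    by (simp only: rate_def restarts_def C_def r_def)
  have rate0: "0 \<le> rate L" unfolding rate using C r by simp
  have "real i \<le> real (\<Sum>l'=1..l. Suc restarts * Suc (window L (\<delta> l')))" using i(1) by (simp only: of_nat_le_iff)
  also have "\<dots> = real (Suc restarts) * (\<Sum>l'=1..l. 1 + real (window L (\<delta> l')))"
    by (simp only: of_nat_sum of_nat_mult sum_distrib_left of_nat_Suc add.commute)
  also have "\<dots> \<le> real (Suc restarts) * (\<Sum>l'=1..l. C * r ^ l')"
    using window_le[OF L0] by (intro mult_left_mono sum_mono) (auto simp: C_def r_def \<delta>_def)
  also have "\<dots> = real (Suc restarts) * C * (\<Sum>l'=1..l. r ^ l')" by (simp add: sum_distrib_left mult.assoc)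
  also have "\<dots> \<le> real (Suc restarts) * C * (r ^ l * (r / (r - 1)))"
    using C by (intro mult_left_mono geometric_sum_le[OF r]) auto
  also have "\<dots> = rate L * r ^ l" by (simp add: rate)
  also have "r ^ l = sqrt (b ^ l)" by (simp add: r_def real_sqrt_power)
  also have "rate L * sqrt (b ^ l) \<le> rate L * (1 + sqrt (b * A * p) * (1 / sqrt \<epsilon>))"
  proof (rule mult_left_mono[OF _ rate0])
    have "sqrt (b ^ l) \<le> sqrt (1 + b * (A * p / \<epsilon>))" using bl by simp
    also have "\<dots> \<le> sqrt 1 + sqrt (b * (A * p / \<epsilon>))"
      using b_ge_2 A_pos p_pos \<epsilon> by (intro sqrt_add_le_add_sqrt) auto
    also have "sqrt (b * (A * p / \<epsilon>)) = sqrt (b * A * p) * (1 / sqrt \<epsilon>)"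
      by (simp add: real_sqrt_mult real_sqrt_divide)
    finally show "sqrt (b ^ l) \<le> 1 + sqrt (b * A * p) * (1 / sqrt \<epsilon>)" by simp
  qed
  finally have "real (Suc i) \<le> iterations L \<epsilon>" by (simp add: iterations_def)
  moreover have "p - F (ybest (Suc i)) \<le> \<epsilon>"
  proof -
    have "A * p \<le> b ^ l * \<epsilon>" using l(1) \<epsilon> by (simp add: divide_le_eq)
    then have "A * \<delta> l * p \<le> \<epsilon>" using b_ge_2 by (simp add: \<delta>_def power_divide divide_le_eq mult.commute)
    then show ?thesis using i(2) by (simp add: best_def)
  qed
  ultimately show ?thesis using ybest_mem[of i] by (intro exI[of _ "Suc i"]) auto
qed

end

section \<open>The convergence rate\<close>

text \<open>A valid \<open>L\<close> is shown to exist, so the second conjunct, which holds for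
  every valid \<open>L\<close>, is not vacuous. \<open>K\<close> is chosen before \<open>G\<close>,
  \<open>\<epsilon>\<close> and \<open>N\<close>, which makes the iteration bound uniform in the
  method and independent of \<open>N\<close>.\<close>

theorem corollary4p3:
  fixes f :: "'a::euclidean_space \<Rightarrow> ennreal"
    and S :: "nat \<Rightarrow> 'a set" and e :: "nat \<Rightarrow> 'a" and m :: nat
    and S0 SS :: "'a set" and e0 x_star x_SL x0 :: 'a
    and p_star :: ennreal
    and D0 R0 \<rho> \<eta> \<tau>0 \<beta> b :: real
    and c :: "real \<Rightarrow> real"
  assumes "hypo_concave f" and "upper_semicontinuous f"
    and "S0 = closure (eff_dom f)" and "bounded S0" and "D0 = diameter S0"
    and "m \<ge> 1"
    and "\<forall>j\<in>{1..m}. closed (S j) \<and> convex (S j)"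
    and "SS = (\<Inter>j\<in>{1..m}. S j)"
    and "e0 \<in> interior S0" and "R0 = inner_radius e0 S0" and "R0 > 0"
    and "\<forall>j\<in>{1..m}. e j \<in> interior (S j)"
    and "p_star = (SUP x\<in>SS. f x)" and "x_star \<in> SS" and "f x_star = p_star" and "p_star > 0"
    and "x_SL \<in> interior SS \<inter> eff_dom f"
    and "\<eta> = (1 - enn2real (set_gauge S0 e0 x_star)) * (1 - enn2real (phi_S m S e x_SL))"
    and "\<eta> > 0"
    and "open (eff_dom f)" and "C2_on (eff_dom f) (\<lambda>x. enn2real (f x))"
    and "smooth_on \<beta> (eff_dom f) (\<lambda>x. enn2real (f x))"
    and "\<forall>j\<in>{1..m}. smooth_set \<beta> (S j) \<and> compact (S j)"
    and "x0 \<in> eff_dom f \<inter> SS" and "\<tau>0 = 1 / enn2real (f x0)" and "b \<ge> 2"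
    and "\<rho> = R0 / (D0 + R0)"
    and "\<forall>\<tau>>0. c \<tau> = 1 / (\<tau> * enn2real p_star) * (R0 / (D0 + R0)) * \<eta>"
  shows "(\<exists>L. valid_smoothness f e0 m S e {1 / enn2real p_star..\<tau>0} L) \<and>
    (\<forall>L. valid_smoothness f e0 m S e {1 / enn2real p_star..\<tau>0} L \<longrightarrow>
      (\<exists>K :: real \<Rightarrow> real. K \<in> O[at_right 0](\<lambda>\<epsilon>. 1 / sqrt \<epsilon>) \<and>
        (\<forall>(G :: ('a, 's) gradient_method) \<epsilon> N.
          accelerated_genGrad G \<longrightarrow> \<epsilon> > 0 \<longrightarrow> N > 0 \<longrightarrow>
          real N \<ge> log b (b * enn2real p_star / (c \<tau>0 * \<rho> * \<epsilon>)) \<longrightarrow>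
          (\<forall>\<tau> s ybest.
            parallel_multiradial_run
              (\<lambda>\<tau>' \<delta> x. genGrad_init G L x)
              (\<lambda>\<tau>'. genGrad_step G L m (Phi_component f e0 S e \<tau>'))
              (gm_iterate G) f SS x0 b N \<tau> s ybest \<longrightarrow>
            (\<exists>i\<ge>1. real i \<le> K \<epsilon> \<and> ybest i \<in> SS \<and>
               enn2real p_star - enn2real (f (ybest i)) \<le> \<epsilon>)))))"
proof -
  interpret radial_objective f e0 \<beta>
    using assms(1-4,9,20,22) by unfold_locales auto
  have x_star: "x_star \<in> eff_dom f"
    using assms(15,16) f_finite[of x_star] by (simp add: eff_dom_def)
  interpret P: multiradial_problem f e0 \<beta> S e m x_star x_SL x0 b
  proof (intro multiradial_problem.intro radial_objective_axioms multiradial_problem_axioms.intro)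
    show "1 \<le> m" by (rule assms(6))
    show "centred_body (S j) (e j)" if "j \<in> {1..m}" for j
      using that assms(7,12,23) by (simp add: centred_body_def)
    show "enn2real (f x) \<le> enn2real (f x_star)" if "x \<in> (\<Inter>j\<in>{1..m}. S j)" for x
    proof (rule enn2real_mono)
      show "f x \<le> f x_star" unfolding assms(15,13) using that assms(8) by (intro SUP_upper) simp
      show "f x_star < top" using f_finite[of x_star] by simp
    qed
  qed (use assms x_star in auto)
  have SS: "P.SS = SS" using assms(8) by (simp add: P.SS_def)
  have p: "P.p = enn2real p_star" using assms(15) by (simp add: P.p_def)
  have \<tau>0: "P.\<tau>0 = \<tau>0" using assms(25) by (simp add: P.\<tau>0_def)
  have \<rho>: "P.\<rho> = \<rho>" using assms(3,5,10,27) by (simp add: P.\<rho>_def)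
  have \<eta>: "P.\<eta> = \<eta>" using assms(3,18) by (simp add: P.\<eta>_def P.\<gamma>_def P.\<phi>_def)
  have "0 < \<tau>0" using P.F_x0_pos assms(25) by simp
  then have c: "c \<tau>0 = enn2real (f x0) / P.p * P.\<rho> * P.\<eta>"
    using assms(25,27,28) by (simp add: \<rho> \<eta> p)
  have target: "P.A * P.p / \<epsilon> \<le> b ^ N"
    if \<epsilon>: "0 < \<epsilon>" and N: "log b (b * enn2real p_star / (c \<tau>0 * \<rho> * \<epsilon>)) \<le> real N" for \<epsilon> N
  proof -
    \<comment> \<open>By the choice of \<open>A\<close> the logarithmic condition on
      \<open>N\<close> says exactly that \<open>b ^ N\<close> is at least
      \<open>P.A * P.p / \<epsilon>\<close>.\<close>
    have eq: "P.A * P.p / \<epsilon> = b * enn2real p_star / (c \<tau>0 * \<rho> * \<epsilon>)"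
      unfolding P.A_def c p[symmetric] \<rho>[symmetric] by (simp add: power2_eq_square mult_ac)
    have "0 < P.A * P.p / \<epsilon>" using P.A_pos P.p_pos \<epsilon> by simp
    then have "P.A * P.p / \<epsilon> \<le> b powr real N"
      using N assms(26) unfolding eq by (subst (asm) log_le_iff) auto
    then show ?thesis using assms(26) by (simp add: powr_realpow)
  qed
  show ?thesis
  proof (intro conjI allI impI)
    show "\<exists>L. valid_smoothness f e0 m S e {1 / enn2real p_star..\<tau>0} L"
      using P.valid_smoothness_exists by (simp add: p \<tau>0)
    fix L assume L: "valid_smoothness f e0 m S e {1 / enn2real p_star..\<tau>0} L"
    have "\<exists>i\<ge>1. real i \<le> P.iterations L \<epsilon> \<and> ybest i \<in> SS \<and> enn2real p_star - enn2real (f (ybest i)) \<le> \<epsilon>"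
      if "accelerated_genGrad G" and \<epsilon>: "0 < \<epsilon>" and "0 < N"
        and N: "log b (b * enn2real p_star / (c \<tau>0 * \<rho> * \<epsilon>)) \<le> real N"
        and "parallel_multiradial_run (\<lambda>\<tau>' \<delta> x. genGrad_init G L x)
          (\<lambda>\<tau>'. genGrad_step G L m (Phi_component f e0 S e \<tau>')) (gm_iterate G) f SS x0 b N \<tau> s ybest"
      for G :: "('a, 's) gradient_method" and \<epsilon> N \<tau> s ybest
    proof -
      interpret R: multiradial_run f e0 \<beta> S e m x_star x_SL x0 b G L N \<tau> s ybest
        using that L by unfold_locales (simp_all add: p \<tau>0 SS)
      show ?thesis
        using R.\<epsilon>_minimizer_found[OF \<epsilon> target[OF \<epsilon> N]] by (simp add: p SS)
    qed
    then show "\<exists>K. K \<in> O[at_right 0](\<lambda>\<epsilon>. 1 / sqrt \<epsilon>) \<and>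
        (\<forall>(G :: ('a, 's) gradient_method) \<epsilon> N.
          accelerated_genGrad G \<longrightarrow> \<epsilon> > 0 \<longrightarrow> N > 0 \<longrightarrow>
          real N \<ge> log b (b * enn2real p_star / (c \<tau>0 * \<rho> * \<epsilon>)) \<longrightarrow>
          (\<forall>\<tau> s ybest.
            parallel_multiradial_run
              (\<lambda>\<tau>' \<delta> x. genGrad_init G L x)
              (\<lambda>\<tau>'. genGrad_step G L m (Phi_component f e0 S e \<tau>'))
              (gm_iterate G) f SS x0 b N \<tau> s ybest \<longrightarrow>
            (\<exists>i\<ge>1. real i \<le> K \<epsilon> \<and> ybest i \<in> SS \<and>
               enn2real p_star - enn2real (f (ybest i)) \<le> \<epsilon>)))"
      using P.iterations_bigo by blast
  qed
qed

end
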